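(* Let $(G_n)$ be a Benjamini--Schramm convergent sequence of finite graphs all of whose degrees are at most $d$, where $d\ge 2$. Put $\omega=2\sqrt{d-1}$ and $K=[-\omega,\omega]$. Then the matching measures $\rho_n=\rho_{G_n}$ converge weakly to a probability measure $\rho$ on $K$. Moreover: (a) as $n\to\infty$, \[\frac{\ln\mathbb M(G_n)}{v(G_n)}\to\frac12\int_K\ln(1+x^2)\,\mathrm d\rho(x),\qquad \frac{\mathbb E\gamma_{G_n}}{v(G_n)}\to\frac12\int_K\frac{x^2}{1+x^2}\,\mathrm d\rho(x),\] \[\frac{\mathbb D^2\gamma_{G_n}}{v(G_n)}\to\frac12\int_K\frac{x^2}{(1+x^2)^2}\,\mathrm d\rho(x),\qquad \frac{\nu(G_n)}{v(G_n)}\to\frac{1-\rho(\{0\})}{2};\] in particular $\ln\mathbb M(G)/v(G)$, $\mathbb E\gamma_G/v(G)$, $\mathbb D^2\gamma_G/v(G)$ and $\nu(G)/v(G)$ are estimable graph parameters; (b) \[\limsup_{n\to\infty}\frac{\ln\operatorname{pm}(G_n)}{v(G_n)}\le\int_K\ln|x|\,\mathrm d\rho(x).\]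
   Context: $v(G)$ is the number of vertices, $m_k(G)$ the number of $k$-edge matchings, $\mathbb M(G)=\sum_k m_k(G)$ the number of matchings, $\operatorname{pm}(G)$ the number of perfect matchings (with $\ln 0=-\infty$), $\nu(G)$ the maximum matching size. The matching polynomial is $\mu(G,x)=\sum_{k}(-1)^k m_k(G)x^{v(G)-2k}$; the matching measure $\rho_G$ is the uniform probability measure on the roots of $\mu(G,x)$ counted with multiplicity. $\gamma_G$ is the number of edges of a uniformly random matching of $G$, with expectation $\mathbb E\gamma_G$ and variance $\mathbb D^2\gamma_G$. For a finite graph $G$, a finite rooted graph $\alpha$ and $r>0$, $\mathbb P(G,\alpha,r)$ is the probability that the $r$-ball around a uniformly random vertex of $G$ is isomorphic to $\alpha$ as a rooted graph; a bounded-degree sequence $(G_n)$ is Benjamini--Schramm convergent if $\mathbb P(G_n,\alpha,r)$ converges for all $\alpha,r$. A graph parameter is estimable if it converges along every Benjamini--Schramm convergent sequence of graphs with uniformly bounded degrees. *)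

theory Defs
  imports "HOL-Probability.Probability" "HOL-Computational_Algebra.Polynomial"
begin

section \<open>Finite simple graphs\<close>

record 'a ugraph =
  verts :: "'a set"
  edges :: "'a set set"

text \<open>Graphs are nonempty, so that a uniformly random vertex and division by the number of
  vertices make sense.\<close>

definition finite_graph :: "'a ugraph \<Rightarrow> bool" where
  "finite_graph G \<longleftrightarrow> finite (verts G) \<and> verts G \<noteq> {} \<and>
     edges G \<subseteq> {e. e \<subseteq> verts G \<and> card e = 2}"

definition vnum :: "'a ugraph \<Rightarrow> nat" where
  "vnum G = card (verts G)"

definition vdegree :: "'a ugraph \<Rightarrow> 'a \<Rightarrow> nat" where
  "vdegree G v = card {e \<in> edges G. v \<in> e}"

definition max_degree_le :: "'a ugraph \<Rightarrow> nat \<Rightarrow> bool" where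
  "max_degree_le G d \<longleftrightarrow> (\<forall>v\<in>verts G. vdegree G v \<le> d)"


section \<open>Matchings\<close>

definition matchings :: "'a ugraph \<Rightarrow> 'a set set set" where
  "matchings G = {M. M \<subseteq> edges G \<and> disjoint M}"

definition num_matchings_of_size :: "'a ugraph \<Rightarrow> nat \<Rightarrow> nat" where
  "num_matchings_of_size G k = card {M \<in> matchings G. card M = k}"

definition num_matchings :: "'a ugraph \<Rightarrow> nat" where
  "num_matchings G = card (matchings G)"

definition num_perfect_matchings :: "'a ugraph \<Rightarrow> nat" where
  "num_perfect_matchings G = card {M \<in> matchings G. \<Union>M = verts G}"

definition matching_number :: "'a ugraph \<Rightarrow> nat" where
  "matching_number G = Max (card ` matchings G)"

text \<open>A matching has at most \<open>vnum G div 2\<close> edges, so the sum runs over all possible sizes and the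
  exponents do not truncate.\<close>

definition matching_poly :: "'a ugraph \<Rightarrow> real poly" where
  "matching_poly G =
     (\<Sum>k\<le>vnum G div 2.
        monom ((- 1) ^ k * real (num_matchings_of_size G k)) (vnum G - 2 * k))"

text \<open>All roots of the matching polynomial of a graph are real (Heilmann--Lieb), so the multiset of
  real roots is the multiset of all roots. The push-forward along the identity turns the discrete
  measure into one on the Borel sets.\<close>

definition matching_measure :: "'a ugraph \<Rightarrow> real measure" where
  "matching_measure G =
     distr (measure_pmf (pmf_of_multiset (proots (matching_poly G)))) borel (\<lambda>x. x)"

definition random_matching_size :: "'a ugraph \<Rightarrow> nat pmf" where
  "random_matching_size G = map_pmf card (pmf_of_set (matchings G))"

definition expected_matching_size :: "'a ugraph \<Rightarrow> real" where
  "expected_matching_size G = measure_pmf.expectation (random_matching_size G) real"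

definition variance_matching_size :: "'a ugraph \<Rightarrow> real" where
  "variance_matching_size G = measure_pmf.variance (random_matching_size G) real"


section \<open>Benjamini--Schramm convergence\<close>

definition adj_rel :: "'a ugraph \<Rightarrow> ('a \<times> 'a) set" where
  "adj_rel G = {(u, w). {u, w} \<in> edges G}"

definition ball_verts :: "'a ugraph \<Rightarrow> 'a \<Rightarrow> nat \<Rightarrow> 'a set" where
  "ball_verts G v r = {w. \<exists>k\<le>r. (v, w) \<in> adj_rel G ^^ k}"

definition induced_subgraph :: "'a ugraph \<Rightarrow> 'a set \<Rightarrow> 'a ugraph" where
  "induced_subgraph G S = \<lparr>verts = S, edges = {e \<in> edges G. e \<subseteq> S}\<rparr>"

definition rooted_ball :: "'a ugraph \<Rightarrow> 'a \<Rightarrow> nat \<Rightarrow> 'a ugraph \<times> 'a" where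
  "rooted_ball G v r = (induced_subgraph G (ball_verts G v r), v)"

definition rooted_iso :: "'a ugraph \<times> 'a \<Rightarrow> 'b ugraph \<times> 'b \<Rightarrow> bool" where
  "rooted_iso A B \<longleftrightarrow>
     (\<exists>f. bij_betw f (verts (fst A)) (verts (fst B)) \<and> f (snd A) = snd B \<and>
        (\<forall>u\<in>verts (fst A). \<forall>w\<in>verts (fst A).
           {u, w} \<in> edges (fst A) \<longleftrightarrow> {f u, f w} \<in> edges (fst B)))"

definition finite_rooted_graph :: "'a ugraph \<times> 'a \<Rightarrow> bool" where
  "finite_rooted_graph A \<longleftrightarrow> finite_graph (fst A) \<and> snd A \<in> verts (fst A)"

definition ball_prob :: "'a ugraph \<Rightarrow> 'b ugraph \<times> 'b \<Rightarrow> nat \<Rightarrow> real" where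
  "ball_prob G A r =
     measure_pmf.prob (pmf_of_set (verts G)) {v. rooted_iso (rooted_ball G v r) A}"

text \<open>Every finite rooted graph is isomorphic to one whose vertices are natural numbers, so it is
  enough to test against those.\<close>

definition bs_convergent :: "(nat \<Rightarrow> 'a ugraph) \<Rightarrow> bool" where
  "bs_convergent G \<longleftrightarrow>
     (\<forall>(A :: nat ugraph \<times> nat) r. finite_rooted_graph A \<longrightarrow> r > 0 \<longrightarrow>
        convergent (\<lambda>n. ball_prob (G n) A r))"

definition estimable :: "('a ugraph \<Rightarrow> real) \<Rightarrow> bool" where
  "estimable p \<longleftrightarrow>
     (\<forall>G d. (\<forall>n. finite_graph (G n)) \<longrightarrow> (\<forall>n. max_degree_le (G n) d) \<longrightarrow> bs_convergent G \<longrightarrow>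
        convergent (\<lambda>n. p (G n)))"


section \<open>Extended logarithm and integral\<close>

text \<open>The library has \<open>ln 0 = 0\<close>, and its Bochner integral of a non-integrable function is \<open>0\<close>.
  Below, the logarithm of \<open>0\<close> is \<open>-\<infinity>\<close>, and the integral of an extended-real function is the
  integral of its positive part minus the integral of its negative part (\<open>e2ennreal\<close> sends negative
  values to \<open>0\<close>), meaningful whenever these are not both infinite.\<close>

definition ext_ln :: "real \<Rightarrow> ereal" where
  "ext_ln x = (if x = 0 then -\<infinity> else ereal (ln x))"

definition ext_integral :: "'a measure \<Rightarrow> ('a \<Rightarrow> ereal) \<Rightarrow> ereal" where
  "ext_integral M f =
     enn2ereal (\<integral>\<^sup>+ x. e2ennreal (f x) \<partial>M) - enn2ereal (\<integral>\<^sup>+ x. e2ennreal (- f x) \<partial>M)"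

end

theory Submission
  imports
    Defs
    "HOL-Computational_Algebra.Fundamental_Theorem_Algebra"
    "HOL-Computational_Algebra.Polynomial_FPS"
    "HOL-Real_Asymp.Real_Asymp"
begin

text \<open>By the Heilmann--Lieb argument the roots \<open>\<lambda>\<^sub>i\<close> of the matching
  polynomial are real and lie in \<open>K\<close>. Since the derivative of \<open>\<mu>(G)\<close> is the sum
  of the matching polynomials \<open>\<mu>(G - v)\<close> over the vertices \<open>v\<close>, the
  \<open>k\<close>-th power sum of the roots is the sum over \<open>v\<close> of the coefficient of
  \<open>z\<^sup>k\<close> in \<open>F(G,v) = z\<^sup>-\<^sup>1 \<mu>(G - v, z\<^sup>-\<^sup>1) / \<mu>(G,
  z\<^sup>-\<^sup>1)\<close>. The recurrence \<open>F(G,v) = 1 / (1 - z\<^sup>2 \<Sum> F(G - v, w))\<close>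
  over the neighbours \<open>w\<close> of \<open>v\<close> shows that this coefficient depends only on the
  \<open>k\<close>-ball at \<open>v\<close>. Hence the moments of the matching measures converge, and as the
  supports lie in a fixed compact set, so do the measures. The identity \<open>(\<Sum>\<^sub>k m\<^sub>k
  t\<^sup>k)\<^sup>2 = \<Prod>\<^sub>i (1 + t \<lambda>\<^sub>i\<^sup>2)\<close> turns the parameters into
  integrals: its logarithm and logarithmic derivatives at \<open>t = 1\<close> give part (a) except for the
  matching number, which is read off the degree. The leading coefficient on the right is the square of a
  positive integer, so few nonzero roots are close to \<open>0\<close>, and the mass of the atom at
  \<open>0\<close> converges as well. When there are perfect matchings that integer is their number, which
  gives (b) by truncating the logarithm.\<close>

unbundle no vec_syntax
unbundle fps_syntax

section \<open>Matching sums of induced subgraphs\<close>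

definition matchings_in :: "'a set set \<Rightarrow> 'a set \<Rightarrow> 'a set set set" where
  "matchings_in E S = {M. M \<subseteq> E \<and> \<Union>M \<subseteq> S \<and> disjoint M}"

text \<open>The homogeneous form lets one recurrence serve all specialisations: \<open>hmp E S x (-1)\<close> is the
  matching polynomial at \<open>x\<close>, \<open>hmp E S 1 t\<close> the matching generating function at \<open>t\<close>. The exponent does
  not truncate, see \<open>card_matching_le\<close>. Vertices are deleted by shrinking \<open>S\<close> with \<open>E\<close> fixed.\<close>

definition hmp :: "'a set set \<Rightarrow> 'a set \<Rightarrow> 'b::comm_semiring_1 \<Rightarrow> 'b \<Rightarrow> 'b" where
  "hmp E S x y = (\<Sum>M\<in>matchings_in E S. x ^ (card S - 2 * card M) * y ^ card M)"

definition nbhd :: "'a set set \<Rightarrow> 'a set \<Rightarrow> 'a \<Rightarrow> 'a set" where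
  "nbhd E S v = {w \<in> S. {v, w} \<in> E}"

section \<open>Matchings and the vertex-deletion recurrence\<close>

lemma finite_matchings_in:
  assumes "finite S" shows "finite (matchings_in E S)"
proof (rule finite_subset)
  show "matchings_in E S \<subseteq> Pow (Pow S)" unfolding matchings_in_def by blast
qed (use assms in auto)

lemma finite_matching:
  assumes "finite S" "M \<in> matchings_in E S" shows "finite M"
proof (rule finite_subset)
  show "M \<subseteq> Pow S" using assms unfolding matchings_in_def by blast
qed (use assms in auto)

lemma finite_nbhd: "finite S \<Longrightarrow> finite (nbhd E S v)"
  unfolding nbhd_def by auto

lemma card_Union_matching:
  assumes E: "\<forall>e\<in>E. card e = 2" and M: "M \<in> matchings_in E S"
  shows "card (\<Union>M) = 2 * card M"
proof -
  have "card (\<Union>M) = sum card M"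
  proof (rule card_Union_disjoint)
    show "pairwise disjnt M" using M
      unfolding matchings_in_def disjoint_def pairwise_def disjnt_def by auto
    show "finite A" if "A \<in> M" for A
    proof -
      have "card A = 2" using E M that unfolding matchings_in_def by blast
      then show ?thesis by (metis card.infinite zero_neq_numeral)
    qed
  qed
  also have "\<dots> = (\<Sum>e\<in>M. 2)"
    by (rule sum.cong) (use E M in \<open>auto simp: matchings_in_def\<close>)
  finally show ?thesis by simp
qed

lemma card_matching_le:
  assumes E: "\<forall>e\<in>E. card e = 2" and S: "finite S" and M: "M \<in> matchings_in E S"
  shows "2 * card M \<le> card S"
proof -
  have "\<Union>M \<subseteq> S" using M unfolding matchings_in_def by auto
  then show ?thesis using card_Union_matching[OF E M] card_mono[OF S] by metis
qed

lemma nbhd_neq: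
  assumes E: "\<forall>e\<in>E. card e = 2" and "w \<in> nbhd E S v"
  shows "w \<noteq> v"
  using bspec[OF E, of "{v}"] assms(2) unfolding nbhd_def by auto

lemma matchings_in_remove:
  "matchings_in E (S - {v}) = {M \<in> matchings_in E S. v \<notin> \<Union>M}"
  unfolding matchings_in_def by auto

lemma hmp_empty [simp]:
  assumes E: "\<forall>e\<in>E. card e = 2"
  shows "hmp E {} x y = 1"
proof -
  have "M = {}" if "M \<in> matchings_in E {}" for M
    using that finite_matching[OF _ that] card_matching_le[OF E _ that] by simp
  moreover have "{} \<in> matchings_in E {}" unfolding matchings_in_def by (auto simp: disjoint_def)
  ultimately have "matchings_in E {} = {{}}" by blast
  then show ?thesis unfolding hmp_def by simp
qed

text \<open>Matchings are sorted by whether they cover v. One that does consists of a unique edge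
  \<open>{v, w}\<close> and a matching of S without v and w, which accounts for the factor y and the
  sum over neighbours.\<close>

lemma hmp_rec:
  assumes E: "\<forall>e\<in>E. card e = 2" and S: "finite S" and v: "v \<in> S"
  shows "hmp E S x y = x * hmp E (S - {v}) x y + y * (\<Sum>w\<in>nbhd E S v. hmp E (S - {v} - {w}) x y)"
proof -
  let ?t = "\<lambda>M::'a set set. x ^ (card S - 2 * card M) * y ^ card M"
  let ?A = "{M \<in> matchings_in E S. v \<notin> \<Union>M}" and ?B = "{M \<in> matchings_in E S. v \<in> \<Union>M}"
  let ?I = "Sigma (nbhd E S v) (\<lambda>w. matchings_in E (S - {v} - {w}))"
  have "hmp E S x y = sum ?t (?A \<union> ?B)"
    unfolding hmp_def by (rule sum.cong) auto
  also have "\<dots> = sum ?t ?A + sum ?t ?B"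
    by (rule sum.union_disjoint) (auto simp: finite_matchings_in S)
  also have "sum ?t ?A = x * hmp E (S - {v}) x y"
    unfolding hmp_def sum_distrib_left matchings_in_remove[symmetric]
  proof (rule sum.cong)
    fix M assume M: "M \<in> matchings_in E (S - {v})"
    have "2 * card M \<le> card (S - {v})" by (rule card_matching_le[OF E _ M]) (use S in auto)
    then have "card S - 2 * card M = Suc (card (S - {v}) - 2 * card M)"
      using card.remove[OF S v] by simp
    then show "?t M = x * (x ^ (card (S - {v}) - 2 * card M) * y ^ card M)"
      by (simp add: algebra_simps)
  qed simp
  \<comment> \<open>The bijection pairs (w, M) with M plus the edge \<open>{v, w}\<close>.
    Disjointness makes the partner of v unique, so it can be recovered by
    \<open>THE\<close>.\<close>
  also have "sum ?t ?B = (\<Sum>p\<in>?I. ?t (insert {v, fst p} (snd p)))"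
  proof (rule sum.reindex_bij_witness[symmetric, where
        j = "\<lambda>p. insert {v, fst p} (snd p)" and
        i = "\<lambda>M. (THE w. {v, w} \<in> M, M - {{v, THE w. {v, w} \<in> M}})"])
    fix p assume p: "p \<in> ?I"
    obtain w M where pw: "p = (w, M)" by force
    from p pw have w: "w \<in> S" "{v, w} \<in> E" "w \<noteq> v" and M: "M \<in> matchings_in E (S - {v} - {w})"
      using nbhd_neq[OF E, of w S v] by (auto simp: nbhd_def)
    have MM: "M \<subseteq> E" "\<Union>M \<subseteq> S - {v} - {w}" "disjoint M" using M unfolding matchings_in_def by auto
    have u: "{v, u} \<in> insert {v, w} M \<longleftrightarrow> u = w" for u
      using MM(2) w(3) by (auto simp: doubleton_eq_iff)
    have the: "(THE u. {v, u} \<in> insert {v, w} M) = w" unfolding u by simp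
    have "{v, w} \<notin> M" using MM(2) by blast
    then show "(THE u. {v, u} \<in> insert {v, fst p} (snd p), insert {v, fst p} (snd p) - {{v, THE u. {v, u} \<in> insert {v, fst p} (snd p)}}) = p"
      unfolding pw fst_conv snd_conv the by simp
    have "disjoint (insert {v, w} M)"
      using MM(2,3) unfolding disjoint_def by blast
    then show "insert {v, fst p} (snd p) \<in> ?B"
      using MM w v pw unfolding matchings_in_def by auto
  next
    fix M assume M: "M \<in> ?B"
    then have MM: "M \<subseteq> E" "\<Union>M \<subseteq> S" "disjoint M" unfolding matchings_in_def by auto
    from M obtain e where e: "e \<in> M" "v \<in> e" by blast
    have "card e = 2" using E e MM by blast
    then obtain a b where ab: "e = {a, b}" "a \<noteq> b" by (meson card_2_iff)
    then obtain w where w: "e = {v, w}" "w \<noteq> v"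
      using e(2) by (metis empty_iff insert_commute insert_iff)
    have u: "{v, u} \<in> M \<longleftrightarrow> u = w" for u
    proof
      assume a: "{v, u} \<in> M"
      have "{v, u} = {v, w}"
        using bspec[OF bspec[OF MM(3)[unfolded disjoint_def] a] e(1)] e(2) w(1) by blast
      then show "u = w" by (simp only: doubleton_eq_iff) (elim disjE conjE; simp)
    qed (use e w in simp)
    have the: "(THE u. {v, u} \<in> M) = w" unfolding u by simp
    show "insert {v, fst (THE w. {v, w} \<in> M, M - {{v, THE w. {v, w} \<in> M}})} (snd (THE w. {v, w} \<in> M, M - {{v, THE w. {v, w} \<in> M}})) = M"
      using e(1) unfolding the fst_conv snd_conv w(1) by (rule insert_Diff)
    have "f \<inter> e = {}" if "f \<in> M - {e}" for f
      using MM(3) e(1) that unfolding disjoint_def by blast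
    then have "\<Union>(M - {e}) \<subseteq> S - {v} - {w}" using MM(2) w by blast
    moreover have "disjoint (M - {e})" using MM(3) unfolding disjoint_def by blast
    ultimately have "M - {e} \<in> matchings_in E (S - {v} - {w})"
      using MM unfolding matchings_in_def by blast
    then show "(THE w. {v, w} \<in> M, M - {{v, THE w. {v, w} \<in> M}}) \<in> ?I"
      unfolding the using e w MM by (auto simp: nbhd_def)
  qed simp
  also have "\<dots> = (\<Sum>w\<in>nbhd E S v. \<Sum>M\<in>matchings_in E (S - {v} - {w}). ?t (insert {v, w} M))"
    by (subst sum.Sigma) (auto simp: S finite_nbhd finite_matchings_in split_def)
  also have "\<dots> = y * (\<Sum>w\<in>nbhd E S v. hmp E (S - {v} - {w}) x y)"
    unfolding hmp_def sum_distrib_left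
  proof (intro sum.cong refl)
    fix w M assume w: "w \<in> nbhd E S v" and M: "M \<in> matchings_in E (S - {v} - {w})"
    have "{v, w} \<notin> M" using M unfolding matchings_in_def by blast
    moreover have "finite M" by (rule finite_matching[OF _ M]) (use S in auto)
    ultimately have "card (insert {v, w} M) = Suc (card M)" by simp
    moreover have "card S = Suc (Suc (card (S - {v} - {w})))"
      using card.remove[OF S v] card.remove[of "S - {v}" w] S w nbhd_neq[OF E w]
      by (auto simp: nbhd_def)
    ultimately show "?t (insert {v, w} M) = y * (x ^ (card (S - {v} - {w}) - 2 * card M) * y ^ card M)"
      by (simp add: algebra_simps)
  qed
  finally show ?thesis .
qed

text \<open>At y = 0 only the empty matching survives. This is the constant term 1 that makes the
  power series \<open>hfps\<close> invertible later.\<close>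

lemma hmp_one_zero:
  assumes "finite S" shows "hmp E S 1 0 = (1 :: 'b::comm_semiring_1)"
proof -
  have "\<forall>M\<in>matchings_in E S. (0::'b) ^ card M = (if M = {} then 1 else 0)"
    using finite_matching[OF assms] by (force simp: power_0_left)
  moreover have "{} \<in> matchings_in E S" unfolding matchings_in_def by (auto simp: disjoint_def)
  ultimately show ?thesis unfolding hmp_def using finite_matchings_in[OF assms] by simp
qed

text \<open>Double counting: a matching M of S is a matching of \<open>S - {v}\<close> for exactly
  the \<open>card S - 2 * card M\<close> vertices v that it misses. The right-hand side is the
  formal derivative of \<open>hmp\<close> in x, written out so that it makes sense in any
  commutative semiring.\<close>

lemma sum_hmp_remove:
  assumes E: "\<forall>e\<in>E. card e = 2" and S: "finite S"
  shows "(\<Sum>v\<in>S. hmp E (S - {v}) x y) =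
    (\<Sum>M\<in>matchings_in E S. of_nat (card S - 2 * card M) * (x ^ (card S - 2 * card M - 1) * y ^ card M))"
proof -
  let ?t = "\<lambda>M::'a set set. x ^ (card S - 2 * card M - 1) * y ^ card M"
  have "(\<Sum>v\<in>S. hmp E (S - {v}) x y) = (\<Sum>v\<in>S. \<Sum>M | M \<in> matchings_in E S \<and> v \<notin> \<Union>M. ?t M)"
    by (intro sum.cong refl)
       (auto simp: hmp_def matchings_in_remove S algebra_simps intro!: sum.cong)
  also have "\<dots> = (\<Sum>M\<in>matchings_in E S. \<Sum>v | v \<in> S \<and> v \<notin> \<Union>M. ?t M)"
    by (rule sum.swap_restrict) (auto simp: S finite_matchings_in)
  also have "\<dots> = (\<Sum>M\<in>matchings_in E S. of_nat (card S - 2 * card M) * ?t M)"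
  proof (rule sum.cong)
    fix M assume M: "M \<in> matchings_in E S"
    then have sub: "\<Union>M \<subseteq> S" unfolding matchings_in_def by auto
    have "{v. v \<in> S \<and> v \<notin> \<Union>M} = S - \<Union>M" by auto
    moreover have "card (S - \<Union>M) = card S - 2 * card M"
      using card_Diff_subset[OF finite_subset[OF sub S] sub] card_Union_matching[OF E M] by simp
    ultimately show "(\<Sum>v | v \<in> S \<and> v \<notin> \<Union>M. ?t M) = of_nat (card S - 2 * card M) * ?t M"
      by simp
  qed simp
  finally show ?thesis .
qed

text \<open>Weighted homogeneity, x having weight 1 and y weight 2. It links the matching polynomial
  at 1/z with the matching generating function at \<open>- (z ^ 2)\<close>, and with z = -1 it gives
  the parity of the matching polynomial.\<close>

lemma hmp_scale:
  assumes E: "\<forall>e\<in>E. card e = 2" and S: "finite S"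
  shows "hmp E S (z * x) (z ^ 2 * y) = z ^ card S * hmp E S x y"
  unfolding hmp_def sum_distrib_left
proof (rule sum.cong)
  fix M assume M: "M \<in> matchings_in E S"
  have "card S = (card S - 2 * card M) + 2 * card M" using card_matching_le[OF E S M] by simp
  then have "z ^ card S = z ^ (card S - 2 * card M) * (z ^ 2) ^ card M"
    by (metis power_add power_mult)
  then show "(z * x) ^ (card S - 2 * card M) * (z ^ 2 * y) ^ card M =
      z ^ card S * (x ^ (card S - 2 * card M) * y ^ card M)"
    by (simp add: power_mult_distrib algebra_simps)
qed simp

text \<open>Induction along \<open>hmp_rec\<close> needs only that neighbourhoods and deletions are
  transported by f, so no bijection between the sets of matchings has to be built.\<close>

lemma hmp_iso:
  assumes E: "\<forall>e\<in>E. card e = 2" and E': "\<forall>e\<in>E'. card e = 2"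
    and S: "finite S" and f: "inj_on f S"
    and iso: "\<And>u w. u \<in> S \<Longrightarrow> w \<in> S \<Longrightarrow> {u, w} \<in> E \<longleftrightarrow> {f u, f w} \<in> E'"
  shows "hmp E' (f ` S) x y = hmp E S x y"
  using S f iso
proof (induction "card S" arbitrary: S rule: less_induct)
  case less
  show ?case
  proof (cases "S = {}")
    case True
    then show ?thesis using E E' by simp
  next
    case False
    then obtain v where v: "v \<in> S" by auto
    have IH: "hmp E' (f ` T) x y = hmp E T x y" if "T \<subseteq> S - {v}" for T
    proof (rule less.hyps)
      have "T \<subset> S" using that v by blast
      then show "card T < card S" using less.prems(1) psubset_card_mono by blast
      show "finite T" "inj_on f T" using that less.prems inj_on_subset finite_subset by blast+
    qed (use that less.prems(3) in auto)
    have im: "f ` (T - {u}) = f ` T - {f u}" if "T \<subseteq> S" "u \<in> S" for T u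
      using that less.prems(2) by (auto simp: inj_on_def)
    have nb: "nbhd E' (f ` S) (f v) = f ` nbhd E S v"
      using less.prems(3) v unfolding nbhd_def by auto
    have nbS: "nbhd E S v \<subseteq> S" unfolding nbhd_def by auto
    have "hmp E' (f ` S) x y = x * hmp E' (f ` (S - {v})) x y
        + y * (\<Sum>w\<in>f ` nbhd E S v. hmp E' (f ` (S - {v}) - {w}) x y)"
      using hmp_rec[OF E', of "f ` S" "f v" x y] less.prems(1) v nb im[of S v] by auto
    also have "(\<Sum>w\<in>f ` nbhd E S v. hmp E' (f ` (S - {v}) - {w}) x y)
        = (\<Sum>w\<in>nbhd E S v. hmp E' (f ` (S - {v} - {w})) x y)"
      using nbS by (subst sum.reindex)
        (auto intro!: sum.cong inj_on_subset[OF less.prems(2)] simp: im[of "S - {v}"])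
    also have "\<dots> = (\<Sum>w\<in>nbhd E S v. hmp E (S - {v} - {w}) x y)"
      by (intro sum.cong refl IH) auto
    also have "hmp E' (f ` (S - {v})) x y = hmp E (S - {v}) x y" by (rule IH) auto
    finally show ?thesis using hmp_rec[OF E less.prems(1) v] by metis
  qed
qed

section \<open>Zero-free regions by the method of Heilmann and Lieb\<close>

lemma card_nbhd_remove:
  assumes S: "finite S" and w: "w \<in> nbhd E S v" and v: "v \<in> S"
  shows "card (nbhd E (S - {v}) w) = card (nbhd E S w) - 1"
proof -
  have "nbhd E (S - {v}) w = nbhd E S w - {v}" unfolding nbhd_def by auto
  moreover have "v \<in> nbhd E S w" using w v unfolding nbhd_def by (auto simp: insert_commute)
  ultimately show ?thesis by simp
qed

text \<open>The second conjunct, a bound on the ratio at a vertex with a missing neighbour, is what makes the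
  induction of Heilmann and Lieb go through.\<close>

lemma hmp_pos_beyond:
  fixes x :: real
  assumes E: "\<forall>e\<in>E. card e = 2" and d: "d \<ge> 2" and x: "x > 2 * sqrt (real d - 1)"
    and S: "finite S" and deg: "\<And>v. v \<in> S \<Longrightarrow> card (nbhd E S v) \<le> d"
  shows "hmp E S x (-1) > 0 \<and>
    (\<forall>v\<in>S. card (nbhd E S v) \<le> d - 1 \<longrightarrow>
       sqrt (real d - 1) * hmp E (S - {v}) x (-1) \<le> hmp E S x (-1))"
  using S deg
proof (induction "card S" arbitrary: S rule: less_induct)
  case less
  define s where "s = sqrt (real d - 1)"
  have s2: "s * s = real d - 1" using d unfolding s_def by simp
  have s0: "s > 0" using d unfolding s_def by simp
  \<comment> \<open>In \<open>S - {v}\<close> every neighbour w of v has lost the neighbour v, so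
    the ratio bound of the induction hypothesis applies to w. Each summand of the recurrence is then
    at most 1/s times \<open>hmp E (S - {v}) x (-1)\<close>.\<close>
  have key: "hmp E (S - {v}) x (-1) > 0 \<and>
     hmp E S x (-1) \<ge> (x - real (card (nbhd E S v)) / s) * hmp E (S - {v}) x (-1)" if v: "v \<in> S" for v
  proof -
    have deg': "card (nbhd E (S - {v}) u) \<le> card (nbhd E S u)" for u
      by (rule card_mono) (use less.prems(1) in \<open>auto simp: nbhd_def\<close>)
    have IH: "hmp E (S - {v}) x (-1) > 0 \<and>
      (\<forall>w\<in>S - {v}. card (nbhd E (S - {v}) w) \<le> d - 1 \<longrightarrow>
       s * hmp E (S - {v} - {w}) x (-1) \<le> hmp E (S - {v}) x (-1))"
      unfolding s_def
    proof (rule less.hyps)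
      show "card (S - {v}) < card S" using v less.prems(1) by (meson card_Diff1_less)
      show "card (nbhd E (S - {v}) u) \<le> d" if "u \<in> S - {v}" for u
        using that less.prems(2)[of u] deg'[of u] by auto
    qed (use less.prems in auto)
    have "hmp E (S - {v} - {w}) x (-1) \<le> hmp E (S - {v}) x (-1) / s" if w: "w \<in> nbhd E S v" for w
    proof -
      have wS: "w \<in> S" "w \<noteq> v" using w nbhd_neq[OF E w] unfolding nbhd_def by auto
      have "card (nbhd E (S - {v}) w) \<le> d - 1"
        using card_nbhd_remove[OF less.prems(1) w v] less.prems(2)[OF wS(1)] by simp
      then have "s * hmp E (S - {v} - {w}) x (-1) \<le> hmp E (S - {v}) x (-1)" using IH wS by auto
      then show ?thesis using s0 by (simp add: field_simps)
    qed
    then have "(\<Sum>w\<in>nbhd E S v. hmp E (S - {v} - {w}) x (-1))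
        \<le> (\<Sum>w\<in>nbhd E S v. hmp E (S - {v}) x (-1) / s)" by (rule sum_mono)
    then show ?thesis
      using IH hmp_rec[OF E less.prems(1) v, of x "-1"] by (simp add: algebra_simps)
  qed
  have pos: "hmp E S x (-1) > 0"
  proof (cases "S = {}")
    case False
    then obtain v where v: "v \<in> S" by auto
    have "real (card (nbhd E S v)) / s \<le> real d / s"
      using less.prems(2)[OF v] s0 by (simp add: divide_right_mono)
    \<comment> \<open>Since \<open>s * s = d - 1\<close>, this is d \<le> 2 (d - 1), where d \<ge> 2
      enters.\<close>
    also have "\<dots> \<le> 2 * s" using s0 s2 d by (simp add: field_simps)
    also have "\<dots> < x" using x unfolding s_def .
    finally have "x - real (card (nbhd E S v)) / s > 0" by simp
    then show ?thesis using key[OF v] by (meson less_le_trans mult_pos_pos)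
  qed (use E in simp)
  moreover have "s * hmp E (S - {v}) x (-1) \<le> hmp E S x (-1)"
    if v: "v \<in> S" and c: "card (nbhd E S v) \<le> d - 1" for v
  proof -
    have "real (card (nbhd E S v)) \<le> s * s" using c d unfolding s2 by linarith
    then have "real (card (nbhd E S v)) / s \<le> s" using s0 by (simp add: field_simps)
    then have "s \<le> x - real (card (nbhd E S v)) / s" using x unfolding s_def by linarith
    then have "s * hmp E (S - {v}) x (-1) \<le> (x - real (card (nbhd E S v)) / s) * hmp E (S - {v}) x (-1)"
      using key[OF v] by (intro mult_right_mono) auto
    then show ?thesis using key[OF v] by linarith
  qed
  ultimately show ?case unfolding s_def by blast
qed

text \<open>The inverse of the ratio at v equals z minus a sum of ratios for \<open>S - {v}\<close>.
  These have negative imaginary part, so the inverse stays in the upper half plane and the ratio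
  itself lies in the lower one. The second conjunct carries the induction.\<close>

lemma hmp_nonzero_upper_half:
  fixes z :: complex
  assumes E: "\<forall>e\<in>E. card e = 2" and z: "Im z > 0" and S: "finite S"
  shows "hmp E S z (-1) \<noteq> 0 \<and> (\<forall>v\<in>S. Im (hmp E (S - {v}) z (-1) / hmp E S z (-1)) < 0)"
  using S
proof (induction "card S" arbitrary: S rule: less_induct)
  case less
  have key: "hmp E S z (-1) \<noteq> 0 \<and> Im (hmp E (S - {v}) z (-1) / hmp E S z (-1)) < 0"
    if v: "v \<in> S" for v
  proof -
    let ?h = "hmp E (S - {v}) z (-1)"
    have IH: "?h \<noteq> 0 \<and> (\<forall>w\<in>S - {v}. Im (hmp E (S - {v} - {w}) z (-1) / ?h) < 0)"
    proof (rule less.hyps)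
      show "card (S - {v}) < card S" using v less.prems(1) by (meson card_Diff1_less)
    qed (use less.prems in simp)
    define q where "q = hmp E S z (-1) / ?h"
    have "q = z - (\<Sum>w\<in>nbhd E S v. hmp E (S - {v} - {w}) z (-1) / ?h)"
      unfolding q_def hmp_rec[OF E less.prems v, of z "-1"] using IH
      by (simp add: diff_divide_distrib sum_divide_distrib)
    moreover have "Im (hmp E (S - {v} - {w}) z (-1) / ?h) \<le> 0" if "w \<in> nbhd E S v" for w
      using IH that nbhd_neq[OF E that] by (auto simp: nbhd_def less_imp_le simp del: Im_divide)
    then have "(\<Sum>w\<in>nbhd E S v. Im (hmp E (S - {v} - {w}) z (-1) / ?h)) \<le> 0" by (rule sum_nonpos)
    ultimately have q: "Im q > 0" using z by (simp del: Im_divide)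
    then have "q \<noteq> 0" by auto
    then have "hmp E S z (-1) \<noteq> 0" unfolding q_def by auto
    moreover have "hmp E (S - {v}) z (-1) / hmp E S z (-1) = inverse q" unfolding q_def by simp
    moreover have "Im (inverse q) < 0"
    proof -
      have "(Re q)\<^sup>2 + (Im q)\<^sup>2 > 0" using q by (simp add: add_nonneg_pos)
      then show ?thesis using q by (simp add: divide_neg_pos)
    qed
    ultimately show ?thesis by simp
  qed
  show ?case
  proof (cases "S = {}")
    case False
    then show ?thesis using key by blast
  qed (use E in simp)
qed

section \<open>Roots of the matching polynomial\<close>

text \<open>The device for specialisation: it is used with evaluation of polynomials, the embedding
  of real into complex polynomials, complex conjugation, and the passage from polynomials to power
  series and to constant terms.\<close>

lemma hmp_hom:
  fixes h :: "'b::comm_semiring_1 \<Rightarrow> 'c::comm_semiring_1"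
  assumes "h 0 = 0" "h 1 = 1" "\<And>a b. h (a + b) = h a + h b" "\<And>a b. h (a * b) = h a * h b"
  shows "h (hmp E S x y) = hmp E S (h x) (h y)"
proof -
  have "h (a ^ k) = h a ^ k" for a k by (induction k) (simp_all add: assms)
  moreover have "h (sum f A) = (\<Sum>a\<in>A. h (f a))" for f and A :: "'a set set set"
    by (induction A rule: infinite_finite_induct) (simp_all add: assms)
  ultimately show ?thesis unfolding hmp_def by (simp add: assms)
qed

lemma map_poly_of_real_mult:
  "map_poly complex_of_real (p * q) = map_poly complex_of_real p * map_poly complex_of_real q"
  by (intro poly_eqI) (simp add: coeff_map_poly coeff_mult)

lemma poly_map_poly_of_real:
  "poly (map_poly complex_of_real p) (of_real x) = of_real (poly p x)"
  by (induction p) (simp_all add: map_poly_pCons)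

text \<open>The fundamental theorem of algebra supplies a complex root, which is real by assumption,
  so a linear factor splits off over the reals and the degree drops.\<close>

lemma poly_real_rooted_factorization:
  fixes p :: "real poly"
  assumes "p \<noteq> 0" and "\<And>z. poly (map_poly complex_of_real p) z = 0 \<Longrightarrow> Im z = 0"
  shows "p = smult (lead_coeff p) (\<Prod>x\<in>#proots p. [:- x, 1:])"
  using assms
proof (induction "degree p" arbitrary: p rule: less_induct)
  case less
  show ?case
  proof (cases "degree p = 0")
    case True
    then obtain c where "p = [:c:]" by (meson degree_eq_zeroE)
    then show ?thesis by simp
  next
    case False
    have "degree (map_poly complex_of_real p) = degree p" by (rule degree_map_poly) simp
    then have "\<not> constant (poly (map_poly complex_of_real p))"
      using False by (simp add: constant_degree)
    then obtain z where z: "poly (map_poly complex_of_real p) z = 0"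
      using fundamental_theorem_of_algebra by blast
    then have "Im z = 0" by (rule less.prems(2))
    then have "z = of_real (Re z)" by (simp add: complex_eq_iff)
    then have "poly p (Re z) = 0" using z
      by (metis of_real_eq_0_iff poly_map_poly_of_real)
    then obtain q where q: "p = [:- Re z, 1:] * q" by (auto simp: poly_eq_0_iff_dvd)
    then have q0: "q \<noteq> 0" using less.prems(1) by auto
    have dq: "degree q < degree p" unfolding q using q0 by (subst degree_mult_eq) auto
    have "q = smult (lead_coeff q) (\<Prod>x\<in>#proots q. [:- x, 1:])"
    proof (rule less.hyps[OF dq q0])
      fix u assume "poly (map_poly complex_of_real q) u = 0"
      then have "poly (map_poly complex_of_real p) u = 0"
        unfolding q map_poly_of_real_mult by simp
      then show "Im u = 0" by (rule less.prems(2))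
    qed
    then have "[:- Re z, 1:] * q = smult (lead_coeff q) ([:- Re z, 1:] * (\<Prod>x\<in>#proots q. [:- x, 1:]))"
      by (metis mult_smult_right)
    then have 1: "p = smult (lead_coeff q) ([:- Re z, 1:] * (\<Prod>x\<in>#proots q. [:- x, 1:]))"
      using q by (rule trans[rotated])
    have 2: "proots p = add_mset (Re z) (proots q)"
      unfolding q using q0 by (subst proots_mult) auto
    have 3: "lead_coeff p = lead_coeff q" unfolding q lead_coeff_mult by simp
    show ?thesis unfolding 2 3 image_mset_add_mset prod_mset.add_mset by (rule 1)
  qed
qed

lemma finite_graphD:
  assumes "finite_graph G"
  shows "\<forall>e\<in>edges G. card e = 2" "finite (verts G)" "vnum G > 0"
    "\<And>e. e \<in> edges G \<Longrightarrow> e \<subseteq> verts G"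
  using assms unfolding finite_graph_def vnum_def by (auto simp: card_gt_0_iff)

lemma matchings_eq:
  assumes "finite_graph G"
  shows "matchings G = matchings_in (edges G) (verts G)"
  using finite_graphD(4)[OF assms] unfolding matchings_def matchings_in_def by blast

text \<open>Grouping the matchings by size brings the matching polynomial into the form to which the
  recurrence applies.\<close>

lemma matching_poly_eq:
  assumes G: "finite_graph G"
  shows "matching_poly G = hmp (edges G) (verts G) [:0, 1:] (- 1)"
proof -
  note g = finite_graphD[OF G]
  let ?N = "matchings_in (edges G) (verts G)"
  have fin: "finite ?N" by (rule finite_matchings_in[OF g(2)])
  have "hmp (edges G) (verts G) [:0, 1:] (- 1) =
      (\<Sum>M\<in>?N. monom ((- 1) ^ card M) (vnum G - 2 * card M) :: real poly)"
    unfolding hmp_def vnum_def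
    by (intro sum.cong refl, cases rule: parity_cases)
       (auto simp: monom_altdef minus_one_power_iff)
  also have "\<dots> = (\<Sum>k\<le>vnum G div 2. \<Sum>M | M \<in> ?N \<and> card M = k. monom ((- 1) ^ card M) (vnum G - 2 * card M))"
    by (rule sum.group[symmetric, where g = card])
       (use fin card_matching_le[OF g(1,2)] in \<open>auto simp: vnum_def less_eq_div_iff_mult_less_eq mult.commute\<close>)
  also have "\<dots> = matching_poly G"
    unfolding matching_poly_def num_matchings_of_size_def matchings_eq[OF G]
    by (intro sum.cong refl) (simp add: of_nat_poly smult_monom mult.commute)
  finally show ?thesis ..
qed

text \<open>Conjugation is a ring homomorphism fixing -1, so a zero in the lower half plane would
  give one in the upper half plane.\<close>

lemma hmp_real_rooted:
  assumes E: "\<forall>e\<in>E. card e = 2" and S: "finite S" and z: "hmp E S z (- 1) = (0::complex)"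
  shows "Im z = 0"
proof (rule ccontr)
  assume "Im z \<noteq> 0"
  then consider "Im z > 0" | "Im (cnj z) > 0" by fastforce
  then show False
  proof cases
    case 1
    then show False using hmp_nonzero_upper_half[OF E _ S] z by blast
  next
    case 2
    have "hmp E S (cnj z) (cnj (- 1)) = cnj (hmp E S z (- 1))"
      by (rule hmp_hom[symmetric]) auto
    then have "hmp E S (cnj z) (- 1) = 0" using z by simp
    then show False using hmp_nonzero_upper_half[OF E 2 S] by blast
  qed
qed

text \<open>Only the empty matching contributes to the power \<open>card S\<close> of the
  variable.\<close>

lemma hmp_lead_coeff:
  assumes E: "\<forall>e\<in>E. card e = 2" and S: "finite S"
  shows "degree (hmp E S [:0, 1:] (- 1) :: real poly) = card S"
    and "lead_coeff (hmp E S [:0, 1:] (- 1) :: real poly) = 1"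
proof -
  let ?p = "hmp E S [:0, 1:] (- 1) :: real poly"
  let ?t = "\<lambda>M::'a set set. [:0, 1:] ^ (card S - 2 * card M) * (- 1) ^ card M :: real poly"
  have t: "?t M = monom ((- 1) ^ card M) (card S - 2 * card M)" for M
    by (auto simp: monom_altdef minus_one_power_iff)
  have e: "{} \<in> matchings_in E S" unfolding matchings_in_def by (auto simp: disjoint_def)
  have c: "coeff ?p k = (\<Sum>M\<in>matchings_in E S. if card S - 2 * card M = k then (- 1) ^ card M else 0)" for k
    unfolding hmp_def t by (simp add: coeff_sum)
  have M0: "M = {}" if "M \<in> matchings_in E S" "card S - 2 * card M = card S" for M
    using card_matching_le[OF E S that(1)] that(2) finite_matching[OF S that(1)]
    by (cases "card M") auto
  have "coeff ?p (card S) = (\<Sum>M\<in>matchings_in E S. if M = {} then 1 else 0)"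
    unfolding c by (intro sum.cong refl) (use M0 in auto)
  then have c1: "coeff ?p (card S) = 1" using e by (simp add: finite_matchings_in[OF S])
  have "degree ?p \<le> card S"
    by (rule degree_le) (auto simp: c intro!: sum.neutral)
  then show d: "degree ?p = card S" using c1 le_degree[of ?p "card S"] by simp
  show "lead_coeff ?p = 1" unfolding d by (rule c1)
qed

text \<open>The roots are listed with multiplicity by an index function, so that sums and products
  over them are ordinary indexed ones. The last conjunct is the factorization that real-rootedness
  provides.\<close>

definition graph_roots :: "'a ugraph \<Rightarrow> (nat \<Rightarrow> real) \<Rightarrow> bool" where
  "graph_roots G lam \<longleftrightarrow> finite_graph G \<and>
     proots (matching_poly G) = image_mset lam (mset_set {..<vnum G}) \<and>
     (\<forall>x. hmp (edges G) (verts G) x (- 1) = (\<Prod>i<vnum G. x - lam i))"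

lemma graph_roots_exist:
  assumes G: "finite_graph G" shows "\<exists>lam. graph_roots G lam"
proof -
  note g = finite_graphD[OF G]
  define p where "p = (hmp (edges G) (verts G) [:0, 1:] (- 1) :: real poly)"
  have pl: "degree p = vnum G" "lead_coeff p = 1"
    unfolding p_def vnum_def by (rule hmp_lead_coeff[OF g(1,2)])+
  \<comment> \<open>\<open>hmp_hom\<close> is applied first to the embedding of coefficients and
    then to evaluation, which makes a complex root of p a zero of \<open>hmp\<close> over the
    complex numbers.\<close>
  have "map_poly complex_of_real p = hmp (edges G) (verts G) (map_poly complex_of_real [:0, 1:]) (map_poly complex_of_real (- 1))"
    unfolding p_def
  proof (rule hmp_hom)
    show "map_poly complex_of_real (a + b) = map_poly complex_of_real a + map_poly complex_of_real b" for a b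
      by (intro poly_eqI) (simp add: coeff_map_poly)
  qed (auto simp: map_poly_of_real_mult)
  also have "map_poly complex_of_real (- 1) = - 1"
    by (intro poly_eqI) (simp add: coeff_map_poly)
  finally have m: "map_poly complex_of_real p = hmp (edges G) (verts G) [:0, 1:] (- 1)"
    by (simp add: map_poly_pCons)
  have "poly (map_poly complex_of_real p) z = hmp (edges G) (verts G) (poly [:0, 1:] z) (poly (- 1) z)" for z
    unfolding m by (rule hmp_hom) auto
  then have "Im z = 0" if "poly (map_poly complex_of_real p) z = 0" for z
    using that hmp_real_rooted[OF g(1,2), of z] by simp
  moreover have "p \<noteq> 0" using pl(2) by auto
  ultimately have p: "p = (\<Prod>x\<in>#proots p. [:- x, 1:])"
    using poly_real_rooted_factorization[of p] pl(2) by simp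
  obtain xs where xs: "mset xs = proots p" using ex_mset by blast
  have nz: "(\<Prod>x\<leftarrow>ys. [:- x, 1:]) \<noteq> (0 :: real poly)" for ys
    by (induction ys) (simp_all del: mult_pCons_left)
  have "degree (\<Prod>x\<leftarrow>xs. [:- x, 1:] :: real poly) = length xs"
    by (induction xs) (simp_all add: degree_mult_eq nz del: mult_pCons_left)
  moreover have "(\<Prod>x\<leftarrow>xs. [:- x, 1:]) = p"
    by (subst p) (simp flip: xs prod_mset_prod_list)
  ultimately have len: "length xs = vnum G" using pl(1) by simp
  define lam where "lam = (!) xs"
  have "mset xs = image_mset lam (mset_set {..<vnum G})"
    unfolding len[symmetric] lam_def
    by (metis map_nth mset_map mset_upt atLeast0LessThan)
  then have pr: "proots p = image_mset lam (mset_set {..<vnum G})" using xs by simp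
  have "hmp (edges G) (verts G) x (- 1) = (\<Prod>i<vnum G. x - lam i)" for x
  proof -
    have "hmp (edges G) (verts G) (poly [:0, 1:] x) (poly (- 1) x) = poly p x"
      unfolding p_def by (rule hmp_hom[symmetric]) auto
    also have "poly p x = poly (\<Prod>i<vnum G. [:- lam i, 1:]) x"
      by (subst p) (simp add: pr image_mset.compositionality o_def prod_unfold_prod_mset)
    finally show ?thesis by (simp add: poly_prod)
  qed
  then show ?thesis using pr G unfolding graph_roots_def p_def matching_poly_eq[OF G] by blast
qed

lemma card_nbhd_le_vdegree:
  assumes G: "finite_graph G"
  shows "card (nbhd (edges G) (verts G) v) \<le> vdegree G v"
proof -
  note g = finite_graphD[OF G]
  have "card (nbhd (edges G) (verts G) v) = card ((\<lambda>w. {v, w}) ` nbhd (edges G) (verts G) v)"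
    by (rule card_image[symmetric]) (auto simp: inj_on_def doubleton_eq_iff)
  also have "\<dots> \<le> vdegree G v"
    unfolding vdegree_def
  proof (rule card_mono)
    have "edges G \<subseteq> Pow (verts G)" using g(4) by auto
    then show "finite {e \<in> edges G. v \<in> e}" using g(2) finite_subset by fastforce
  qed (auto simp: nbhd_def)
  finally show ?thesis .
qed

lemma graph_roots_bound:
  assumes lam: "graph_roots G lam" and d: "d \<ge> 2" "max_degree_le G d" and i: "i < vnum G"
  shows "\<bar>lam i\<bar> \<le> 2 * sqrt (real d - 1)"
proof (rule ccontr)
  assume c: "\<not> \<bar>lam i\<bar> \<le> 2 * sqrt (real d - 1)"
  have G: "finite_graph G" using lam unfolding graph_roots_def by blast
  note g = finite_graphD[OF G]
  have "hmp (edges G) (verts G) \<bar>lam i\<bar> (- 1) > 0"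
  proof -
    have "card (nbhd (edges G) (verts G) v) \<le> d" if "v \<in> verts G" for v
      using card_nbhd_le_vdegree[OF G, of v] d(2) that unfolding max_degree_le_def by force
    then show ?thesis using hmp_pos_beyond[OF g(1) d(1) _ g(2)] c by simp
  qed
  moreover have "hmp (edges G) (verts G) (lam i) (- 1) = 0"
    using lam i unfolding graph_roots_def by (auto intro: prod_zero)
  \<comment> \<open>Homogeneity with z = -1: the roots are symmetric about 0, so positivity to the
    right of the interval also excludes roots to its left.\<close>
  moreover have "hmp (edges G) (verts G) (- lam i) (- 1) = (- 1) ^ card (verts G) * hmp (edges G) (verts G) (lam i) (- 1)"
    using hmp_scale[OF g(1,2), of "- 1" "lam i" "- 1"] by simp
  ultimately show False by (cases "lam i \<ge> 0") auto
qed

section \<open>The matching measure and product formulas over the roots\<close>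

lemma matching_measure_eq:
  assumes lam: "graph_roots G lam"
  shows "matching_measure G = distr (measure_pmf (pmf_of_set {..<vnum G})) borel lam"
proof -
  have n: "{..<vnum G} \<noteq> {}" using lam finite_graphD(3)[of G] unfolding graph_roots_def by auto
  have "proots (matching_poly G) = image_mset lam (mset_set {..<vnum G})"
    using lam unfolding graph_roots_def by blast
  then have "pmf_of_multiset (proots (matching_poly G)) = map_pmf lam (pmf_of_set {..<vnum G})"
    using map_pmf_of_set[OF _ n, of lam] by simp
  then show ?thesis
    unfolding matching_measure_def by (simp add: map_pmf_rep_eq distr_distr o_def)
qed

text \<open>This is the reversed matching polynomial: homogeneity is applied at 1/z and each factor
  \<open>1 / z - lam i\<close> absorbs one power of z. The value z = 0 is treated apart.\<close>

lemma hmp_one_neg_square: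
  assumes lam: "graph_roots G lam"
  shows "hmp (edges G) (verts G) 1 (- (z ^ 2)) = (\<Prod>i<vnum G. 1 - z * lam i)"
proof (cases "z = 0")
  case True
  then show ?thesis
    using hmp_one_zero[of "verts G" "edges G"] finite_graphD(2)[of G] lam by (simp add: graph_roots_def)
next
  case False
  have G: "finite_graph G" using lam unfolding graph_roots_def by blast
  have "hmp (edges G) (verts G) 1 (- (z ^ 2)) = z ^ vnum G * hmp (edges G) (verts G) (1 / z) (- 1)"
    using hmp_scale[OF finite_graphD(1,2)[OF G], of z "1 / z" "- 1"] False by (simp add: vnum_def)
  also have "\<dots> = (\<Prod>i<vnum G. z) * (\<Prod>i<vnum G. 1 / z - lam i)"
    using lam unfolding graph_roots_def by simp
  also have "\<dots> = (\<Prod>i<vnum G. 1 - z * lam i)"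
    unfolding prod.distrib[symmetric] using False by (intro prod.cong) (auto simp: field_simps)
  finally show ?thesis .
qed

lemma poly_eq_infinite:
  fixes p q :: "real poly"
  assumes "\<And>t. t \<in> A \<Longrightarrow> poly p t = poly q t" "infinite A"
  shows "p = q"
proof (rule ccontr)
  assume "p \<noteq> q"
  then have "finite {t. poly (p - q) t = 0}" by (intro poly_roots_finite) simp
  moreover have "A \<subseteq> {t. poly (p - q) t = 0}" using assms by auto
  ultimately show False using assms(2) finite_subset by blast
qed

text \<open>For t = -(z^2) the formulas of \<open>hmp_one_neg_square\<close> for z and -z are
  multiplied, and each pair of factors gives 1 + t \<lambda>^2. Squaring avoids choosing one root
  from each pair of opposite ones. Negative t suffice, as two polynomials that agree at infinitely
  many points are equal.\<close>

lemma hmp_square_poly: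
  assumes lam: "graph_roots G lam"
  shows "(hmp (edges G) (verts G) 1 [:0, 1:]) ^ 2 = (\<Prod>i<vnum G. [:1, lam i ^ 2:])"
proof (rule poly_eq_infinite)
  fix t :: real assume t: "t \<in> {..<0}"
  define z where "z = sqrt (- t)"
  have z: "t = - (z ^ 2)" using t unfolding z_def by simp
  have "poly (hmp (edges G) (verts G) 1 [:0, 1:]) t = hmp (edges G) (verts G) (poly 1 t) (poly [:0, 1:] t)"
    by (rule hmp_hom) auto
  then have h: "poly (hmp (edges G) (verts G) 1 [:0, 1:]) t = hmp (edges G) (verts G) 1 t" by simp
  have "hmp (edges G) (verts G) 1 t = (\<Prod>i<vnum G. 1 - z * lam i)"
    "hmp (edges G) (verts G) 1 t = (\<Prod>i<vnum G. 1 - (- z) * lam i)"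
    unfolding z using hmp_one_neg_square[OF lam, of z] hmp_one_neg_square[OF lam, of "- z"] by auto
  then have "(hmp (edges G) (verts G) 1 t) ^ 2 = (\<Prod>i<vnum G. (1 - z * lam i) * (1 - (- z) * lam i))"
    unfolding power2_eq_square prod.distrib by simp
  also have "\<dots> = (\<Prod>i<vnum G. 1 + t * lam i ^ 2)"
    unfolding z by (intro prod.cong) (auto simp: algebra_simps power2_eq_square)
  finally show "poly ((hmp (edges G) (verts G) 1 [:0, 1:]) ^ 2) t = poly (\<Prod>i<vnum G. [:1, lam i ^ 2:]) t"
    by (simp add: h poly_prod)
qed (rule infinite_Iio)

lemma hmp_square:
  fixes t :: real
  assumes lam: "graph_roots G lam"
  shows "(hmp (edges G) (verts G) 1 t) ^ 2 = (\<Prod>i<vnum G. 1 + t * lam i ^ 2)"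
proof -
  have "poly (hmp (edges G) (verts G) 1 [:0, 1:]) t = hmp (edges G) (verts G) (poly 1 t) (poly [:0, 1:] t)"
    by (rule hmp_hom) auto
  then have "(hmp (edges G) (verts G) 1 t) ^ 2 = poly ((hmp (edges G) (verts G) 1 [:0, 1:]) ^ 2) t" by simp
  then show ?thesis unfolding hmp_square_poly[OF lam] by (simp add: poly_prod)
qed

section \<open>Moments are local\<close>

abbreviation hfps :: "'a set set \<Rightarrow> 'a set \<Rightarrow> real fps" where
  "hfps E S \<equiv> hmp E S 1 (- (fps_X ^ 2))"

text \<open>The coefficients count the closed walks at \<open>v\<close> in Godsil's path tree, and so depend on finite balls only.\<close>

definition walk_gf :: "'a set set \<Rightarrow> 'a set \<Rightarrow> 'a \<Rightarrow> real fps" where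
  "walk_gf E S v = hfps E (S - {v}) * inverse (hfps E S)"

lemma hfps_nth_0:
  assumes "finite S" shows "hfps E S $ 0 = 1"
proof -
  have "hfps E S $ 0 = hmp E S (1 $ 0) ((- (fps_X ^ 2)) $ 0)"
    by (rule hmp_hom[of "\<lambda>f. f $ 0"]) auto
  then show ?thesis using hmp_one_zero[OF assms, of E] by (simp add: power2_eq_square)
qed

text \<open>The recurrence \<open>hmp_rec\<close> divided by \<open>hfps E S\<close>: a continued
  fraction for the ratio, multiplied out so that coefficients can be compared.\<close>

lemma walk_gf_rec:
  assumes E: "\<forall>e\<in>E. card e = 2" and S: "finite S" and v: "v \<in> S"
  shows "walk_gf E S v = 1 + fps_X ^ 2 * ((\<Sum>w\<in>nbhd E S v. walk_gf E (S - {v}) w) * walk_gf E S v)"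
proof -
  have inv: "hfps E T * inverse (hfps E T) = 1" if "finite T" for T
    using hfps_nth_0[OF that, of E] by (subst mult.commute) (intro inverse_mult_eq_1, simp)
  \<comment> \<open>Inserting \<open>hfps E (S - {v})\<close> and its inverse splits the quotient
    into the ratio at w in \<open>S - {v}\<close> and the ratio at v in S.\<close>
  have w: "hfps E (S - {v} - {w}) * inverse (hfps E S) = walk_gf E (S - {v}) w * walk_gf E S v" for w
  proof -
    have "walk_gf E (S - {v}) w * walk_gf E S v = hfps E (S - {v} - {w}) * inverse (hfps E S) *
        (hfps E (S - {v}) * inverse (hfps E (S - {v})))"
      unfolding walk_gf_def by (simp only: mult_ac)
    then show ?thesis using inv[of "S - {v}"] S by simp
  qed
  have "hfps E S = hfps E (S - {v}) - fps_X ^ 2 * (\<Sum>w\<in>nbhd E S v. hfps E (S - {v} - {w}))"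
    using hmp_rec[OF E S v, of 1 "- (fps_X ^ 2) :: real fps"] by simp
  then have "hfps E S * inverse (hfps E S) = walk_gf E S v
      - fps_X ^ 2 * (\<Sum>w\<in>nbhd E S v. hfps E (S - {v} - {w}) * inverse (hfps E S))"
    by (subst (1) \<open>hfps E S = _\<close>) (simp only: walk_gf_def left_diff_distrib mult.assoc sum_distrib_right)
  then show ?thesis unfolding w inv[OF S] sum_distrib_right by (simp add: algebra_simps)
qed

text \<open>Apart from the constant term, a coefficient of index i is determined by coefficients of
  index at most i - 2, at v itself and at its neighbours. This drives the induction in
  \<open>walk_gf_local\<close>.\<close>

lemma walk_gf_nth:
  assumes E: "\<forall>e\<in>E. card e = 2" and S: "finite S" and v: "v \<in> S"
  shows "walk_gf E S v $ i = (if i = 0 then 1 else 0) + (if i < 2 then 0 else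
    \<Sum>j\<le>i - 2. (\<Sum>w\<in>nbhd E S v. walk_gf E (S - {v}) w $ j) * walk_gf E S v $ (i - 2 - j))"
  by (subst walk_gf_rec[OF assms])
    (simp add: fps_X_power_mult_nth, simp add: fps_mult_nth fps_sum_nth atLeast0AtMost)

text \<open>The vertices on self-avoiding walks of length at most k that start at v and stay in S.
  The set S shrinks along the walk exactly as it does in \<open>walk_gf_rec\<close>.\<close>

fun path_ball :: "'a set set \<Rightarrow> nat \<Rightarrow> 'a set \<Rightarrow> 'a \<Rightarrow> 'a set" where
  "path_ball E 0 S v = {v}"
| "path_ball E (Suc k) S v = insert v (\<Union>w\<in>nbhd E S v. path_ball E k (S - {v}) w)"

lemma path_ball_root: "v \<in> path_ball E k S v"
  by (cases k) auto

lemma path_ball_subset: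
  assumes E: "\<forall>e\<in>E. card e = 2"
  shows "v \<in> S \<Longrightarrow> path_ball E k S v \<subseteq> S"
proof (induction k arbitrary: S v)
  case (Suc k)
  have "path_ball E k (S - {v}) w \<subseteq> S" if "w \<in> nbhd E S v" for w
  proof -
    have "w \<in> S - {v}" using that nbhd_neq[OF E that] unfolding nbhd_def by auto
    then show ?thesis using Suc.IH[of w "S - {v}"] by blast
  qed
  then show ?case using Suc.prems by auto
qed simp

lemma walk_gf_local:
  assumes E: "\<forall>e\<in>E. card e = 2"
  shows "finite S \<Longrightarrow> T \<subseteq> S \<Longrightarrow> v \<in> S \<Longrightarrow> path_ball E k S v \<subseteq> T \<Longrightarrow> i \<le> k \<Longrightarrow>
    walk_gf E S v $ i = walk_gf E T v $ i"
proof (induction k arbitrary: S T v i)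
  case 0
  have "v \<in> T" "finite T" using 0 finite_subset by auto
  then show ?case
    using 0 walk_gf_nth[OF E, of S v 0] walk_gf_nth[OF E, of T v 0] by simp
next
  case (Suc k)
  have vT: "v \<in> T" and T: "finite T" using Suc.prems finite_subset by auto
  have nbT: "w \<in> T \<and> w \<in> S \<and> w \<noteq> v \<and> path_ball E k (S - {v}) w \<subseteq> T - {v}" if w: "w \<in> nbhd E S v" for w
  proof -
    have "w \<in> S - {v}" using w nbhd_neq[OF E w] unfolding nbhd_def by auto
    moreover have "path_ball E k (S - {v}) w \<subseteq> T" using Suc.prems(4) w by auto
    ultimately show ?thesis
      using path_ball_root[of w E k "S - {v}"] path_ball_subset[OF E, of w "S - {v}" k] by blast
  qed
  have nb: "nbhd E T v = nbhd E S v"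
    using nbT Suc.prems(2) unfolding nbhd_def by auto
  \<comment> \<open>In \<open>walk_gf_nth\<close> the factors at neighbours are covered by the outer
    induction on k. The other factor has the same root and the same set, so it needs an inner
    induction on i.\<close>
  show ?case using Suc.prems(5)
  proof (induction i rule: less_induct)
    case (less i)
    have 1: "walk_gf E (S - {v}) w $ j = walk_gf E (T - {v}) w $ j"
      if "w \<in> nbhd E S v" "i \<ge> 2" "j \<le> i - 2" for w j
      using nbT[OF that(1)] that less.prems Suc.prems(1,2)
      by (intro Suc.IH) auto
    have 2: "walk_gf E S v $ (i - 2 - j) = walk_gf E T v $ (i - 2 - j)" if "i \<ge> 2" for j
      using that less.prems by (intro less.IH) auto
    show ?case
      unfolding walk_gf_nth[OF E Suc.prems(1,3), of i] walk_gf_nth[OF E T vT, of i] nb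
      using 1 2 by (auto intro!: sum.cong)
  qed
qed

section \<open>Reduction to rooted balls and their isomorphism types\<close>

lemma path_ball_ball_verts: "path_ball (edges G) k S v \<subseteq> ball_verts G v k"
proof (induction k arbitrary: S v)
  case 0
  show ?case by (auto simp: ball_verts_def intro!: exI[of _ 0])
next
  case (Suc k)
  have "u \<in> ball_verts G v (Suc k)"
    if w: "w \<in> nbhd (edges G) S v" and u: "u \<in> path_ball (edges G) k (S - {v}) w" for u w
  proof -
    obtain j where "j \<le> k" "(w, u) \<in> adj_rel G ^^ j"
      using u Suc.IH unfolding ball_verts_def by blast
    moreover have "(v, w) \<in> adj_rel G" using w unfolding nbhd_def adj_rel_def by simp
    ultimately have "Suc j \<le> Suc k" "(v, u) \<in> adj_rel G ^^ Suc j"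
      by (auto simp del: relpow.simps intro: relpow_Suc_I2)
    then show ?thesis unfolding ball_verts_def by blast
  qed
  moreover have "v \<in> ball_verts G v (Suc k)"
    by (auto simp: ball_verts_def intro!: exI[of _ 0])
  ultimately show ?case by auto
qed

lemma ball_verts_subset:
  assumes G: "finite_graph G" and v: "v \<in> verts G"
  shows "ball_verts G v r \<subseteq> verts G"
proof -
  have "u \<in> verts G" if "(v, u) \<in> adj_rel G ^^ k" for u k
  proof (cases k)
    case (Suc m)
    then obtain y where "(y, u) \<in> adj_rel G" using \<open>(v, u) \<in> adj_rel G ^^ k\<close> by auto
    then show ?thesis using finite_graphD(4)[OF G] unfolding adj_rel_def by auto
  qed (use that v in auto)
  then show ?thesis unfolding ball_verts_def by auto
qed

lemma rooted_ball_finite: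
  assumes G: "finite_graph G" and v: "v \<in> verts G"
  shows "finite_rooted_graph (rooted_ball G v r)"
proof -
  have "v \<in> ball_verts G v r" by (auto simp: ball_verts_def intro!: exI[of _ 0])
  then show ?thesis
    using ball_verts_subset[OF assms, of r] finite_subset finite_graphD[OF G]
    unfolding finite_rooted_graph_def finite_graph_def rooted_ball_def induced_subgraph_def by auto
qed

text \<open>Having the rooted graph as a single argument allows evaluation on a graph, on its balls
  and on representatives of their isomorphism types alike.\<close>

definition root_moment :: "'a ugraph \<times> 'a \<Rightarrow> nat \<Rightarrow> real" where
  "root_moment A k = walk_gf (edges (fst A)) (verts (fst A)) (snd A) $ k"

lemma root_moment_ball:
  assumes G: "finite_graph G" and v: "v \<in> verts G" and k: "k \<le> r"
  shows "root_moment (rooted_ball G v r) k = root_moment (G, v) k"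
proof -
  let ?T = "ball_verts G v r"
  note g = finite_graphD[OF G]
  have "ball_verts G v k \<subseteq> ?T" using k unfolding ball_verts_def by (auto intro: order_trans)
  then have "path_ball (edges G) k (verts G) v \<subseteq> ?T" using path_ball_ball_verts by fast
  then have "walk_gf (edges G) (verts G) v $ k = walk_gf (edges G) ?T v $ k"
    by (intro walk_gf_local[OF g(1,2) ball_verts_subset[OF G v] v]) auto
  \<comment> \<open>A matching inside T only uses edges inside the ball, so passing to the induced
    subgraph changes no matching sum.\<close>
  moreover have "matchings_in {e \<in> edges G. e \<subseteq> ?T} T = matchings_in (edges G) T" if "T \<subseteq> ?T" for T
    using that unfolding matchings_in_def by blast
  then have "walk_gf {e \<in> edges G. e \<subseteq> ?T} ?T v = walk_gf (edges G) ?T v"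
    unfolding walk_gf_def hmp_def by simp
  ultimately show ?thesis
    unfolding root_moment_def rooted_ball_def induced_subgraph_def by simp
qed

lemma root_moment_iso:
  assumes A: "finite_rooted_graph A" and B: "finite_rooted_graph B" and iso: "rooted_iso A B"
  shows "root_moment A k = root_moment B k"
proof -
  have gA: "finite_graph (fst A)" and gB: "finite_graph (fst B)" and v: "snd A \<in> verts (fst A)"
    using A B unfolding finite_rooted_graph_def by auto
  obtain f where f: "bij_betw f (verts (fst A)) (verts (fst B))" "f (snd A) = snd B"
    and e: "\<And>u w. u \<in> verts (fst A) \<Longrightarrow> w \<in> verts (fst A) \<Longrightarrow>
         {u, w} \<in> edges (fst A) \<longleftrightarrow> {f u, f w} \<in> edges (fst B)"
    using iso unfolding rooted_iso_def by metis
  have h: "hfps (edges (fst B)) (f ` T) = hfps (edges (fst A)) T" if "T \<subseteq> verts (fst A)" for T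
  proof (rule hmp_iso[OF finite_graphD(1)[OF gA] finite_graphD(1)[OF gB]])
    show "finite T" using that finite_graphD(2)[OF gA] by (rule finite_subset)
    show "inj_on f T" by (rule inj_on_subset[OF bij_betw_imp_inj_on[OF f(1)] that])
    show "{u, w} \<in> edges (fst A) \<longleftrightarrow> {f u, f w} \<in> edges (fst B)" if "u \<in> T" "w \<in> T" for u w
      using \<open>T \<subseteq> verts (fst A)\<close> that by (intro e) auto
  qed
  have im: "f ` verts (fst A) = verts (fst B)" using f(1) by (rule bij_betw_imp_surj_on)
  moreover have "f ` (verts (fst A) - {snd A}) = verts (fst B) - {snd B}"
    using inj_on_image_set_diff[OF bij_betw_imp_inj_on[OF f(1)], of "verts (fst A)" "{snd A}"] v im f(2)
    by simp
  ultimately show ?thesis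
    using h[of "verts (fst A)"] h[of "verts (fst A) - {snd A}"]
    unfolding root_moment_def walk_gf_def by simp
qed

section \<open>Power sums of the roots\<close>

lemma fps_geometric: "inverse (1 - fps_const c * fps_X) $ k = (c::real) ^ k"
proof -
  have "(1 - fps_const c * fps_X) * Abs_fps (\<lambda>n. c ^ n) = 1"
  proof (rule fps_ext)
    fix n show "((1 - fps_const c * fps_X) * Abs_fps (\<lambda>n. c ^ n)) $ n = 1 $ n"
      by (cases n) (simp_all add: left_diff_distrib mult.assoc)
  qed
  then have "inverse (1 - fps_const c * fps_X) = Abs_fps (\<lambda>n. c ^ n)" by (rule fps_inverse_unique)
  then show ?thesis by simp
qed

text \<open>Newton's identity in generating form. With P the product and n the number of factors, n
  - X P'/P is the generating function of the power sums of the c(i). It is stated after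
  multiplication by P.\<close>

lemma fps_prod_linear_deriv:
  fixes c :: "'i \<Rightarrow> real"
  assumes "finite I"
  shows "of_nat (card I) * (\<Prod>i\<in>I. 1 - fps_const (c i) * fps_X)
      - fps_X * fps_deriv (\<Prod>i\<in>I. 1 - fps_const (c i) * fps_X)
    = (\<Prod>i\<in>I. 1 - fps_const (c i) * fps_X) * (\<Sum>i\<in>I. inverse (1 - fps_const (c i) * fps_X))"
  using assms
proof (induction I)
  case (insert a I)
  define g where "g = 1 - fps_const (c a) * fps_X"
  define P where "P = (\<Prod>i\<in>I. 1 - fps_const (c i) * fps_X)"
  define \<Sigma> where "\<Sigma> = (\<Sum>i\<in>I. inverse (1 - fps_const (c i) * fps_X))"
  have IH: "of_nat (card I) * P - fps_X * fps_deriv P = P * \<Sigma>"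
    using insert.IH unfolding P_def \<Sigma>_def .
  have gi: "g * inverse g = 1" unfolding g_def by (subst mult.commute) (intro inverse_mult_eq_1, simp)
  have gd: "g - fps_X * fps_deriv g = 1" unfolding g_def by (simp add: mult.commute)
  have "of_nat (card (insert a I)) * (g * P) - fps_X * fps_deriv (g * P)
      = g * (of_nat (card I) * P - fps_X * fps_deriv P) + P * (g - fps_X * fps_deriv g)"
    using insert.hyps by (simp add: algebra_simps)
  also have "\<dots> = g * (P * \<Sigma>) + P * (g * inverse g)" unfolding IH gd gi ..
  also have "\<dots> = g * P * (inverse g + \<Sigma>)" by (simp only: distrib_left mult_ac add_ac)
  finally show ?case
    using insert.hyps unfolding P_def \<Sigma>_def g_def by simp
qed simp

text \<open>With H = \<open>hfps (edges G) (verts G)\<close> and n = \<open>vnum G\<close>, the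
  series n H - X H' is computed twice: as a sum over deleted vertices by
  \<open>sum_hmp_remove\<close>, and in terms of the roots by \<open>fps_prod_linear_deriv\<close>.
  Dividing by H and comparing coefficients gives the claim.\<close>

lemma sum_root_moment:
  assumes lam: "graph_roots G lam"
  shows "(\<Sum>v\<in>verts G. root_moment (G, v) k) = (\<Sum>i<vnum G. lam i ^ k)"
proof -
  have G: "finite_graph G" using lam unfolding graph_roots_def by blast
  note g = finite_graphD[OF G]
  let ?h = "hfps (edges G)" and ?V = "verts G" and ?N = "matchings_in (edges G) (verts G)"
  let ?y = "- (fps_X ^ 2) :: real fps"
  have inv: "?h ?V * inverse (?h ?V) = 1"
    using hfps_nth_0[OF g(2), of "edges G"] by (subst mult.commute) (intro inverse_mult_eq_1, simp)
  \<comment> \<open>The product formula is known pointwise, so it is first made an identity of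
    polynomials and then carried over to power series.\<close>
  have "hmp (edges G) ?V 1 (- ([:0, 1 :: real:] ^ 2)) = (\<Prod>i<vnum G. [:1, - lam i:])"
  proof (rule iffD1[OF poly_eq_poly_eq_iff], rule ext)
    fix z :: real
    have "poly (hmp (edges G) ?V 1 (- ([:0, 1 :: real:] ^ 2))) z =
      hmp (edges G) ?V (poly 1 z) (poly (- ([:0, 1 :: real:] ^ 2)) z)"
      by (rule hmp_hom) auto
    then show "poly (hmp (edges G) ?V 1 (- ([:0, 1 :: real:] ^ 2))) z = poly (\<Prod>i<vnum G. [:1, - lam i:]) z"
      using hmp_one_neg_square[OF lam, of z] by (simp add: poly_prod)
  qed
  then have "fps_of_poly (hmp (edges G) ?V 1 (- ([:0, 1 :: real:] ^ 2))) = (\<Prod>i<vnum G. fps_of_poly [:1, - lam i:])"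
    by (simp add: fps_of_poly_prod)
  moreover have "fps_of_poly (hmp (edges G) ?V 1 (- ([:0, 1 :: real:] ^ 2))) =
      hmp (edges G) ?V (fps_of_poly 1) (fps_of_poly (- ([:0, 1 :: real:] ^ 2)))"
    by (rule hmp_hom) (auto simp: fps_of_poly_add fps_of_poly_mult)
  moreover have "fps_of_poly (- ([:0, 1 :: real:] ^ 2)) = ?y"
    by (simp add: fps_of_poly_uminus fps_of_poly_power fps_of_poly_fps_X)
  moreover have "fps_of_poly [:1, - lam i:] = 1 - fps_const (lam i) * fps_X" for i
    by (simp add: fps_of_poly_linear)
  ultimately have h: "?h ?V = (\<Prod>i<vnum G. 1 - fps_const (lam i) * fps_X)" by simp
  \<comment> \<open>X d/dX multiplies the term of a matching with c edges by 2c, the number of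
    vertices it covers.\<close>
  have d: "fps_X * fps_deriv (?y ^ c) = of_nat (2 * c) * ?y ^ c" for c
  proof (induction c)
    case (Suc c)
    have "fps_X * fps_deriv (?y ^ Suc c) = fps_X * fps_deriv ?y * ?y ^ c + ?y * (fps_X * fps_deriv (?y ^ c))"
      by (simp only: power_Suc fps_deriv_mult distrib_left mult_ac add_ac)
    also have "fps_X * fps_deriv ?y = 2 * ?y" by (simp add: power2_eq_square)
    finally show ?case unfolding Suc.IH by (simp only: power_Suc of_nat_Suc mult_Suc_right of_nat_add)
      (simp add: distrib_right distrib_left mult_ac)
  qed simp
  have "of_nat (vnum G) * ?h ?V - fps_X * fps_deriv (?h ?V)
      = (\<Sum>M\<in>?N. (of_nat (vnum G) - of_nat (2 * card M)) * ?y ^ card M)"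
    unfolding hmp_def by (simp only: fps_deriv_sum sum_distrib_left sum_subtractf power_one mult_1_left d left_diff_distrib)
  also have "\<dots> = (\<Sum>M\<in>?N. of_nat (vnum G - 2 * card M) * ?y ^ card M)"
    using card_matching_le[OF g(1,2)] by (intro sum.cong refl) (simp add: vnum_def of_nat_diff)
  also have "\<dots> = (\<Sum>v\<in>?V. ?h (?V - {v}))"
    unfolding sum_hmp_remove[OF g(1,2)] vnum_def by simp
  finally have "(\<Sum>v\<in>?V. ?h (?V - {v})) = ?h ?V * (\<Sum>i<vnum G. inverse (1 - fps_const (lam i) * fps_X))"
    using fps_prod_linear_deriv[of "{..<vnum G}" lam] unfolding h by simp
  then have "(\<Sum>v\<in>?V. walk_gf (edges G) ?V v)
      = (\<Sum>i<vnum G. inverse (1 - fps_const (lam i) * fps_X)) * (?h ?V * inverse (?h ?V))"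
    unfolding walk_gf_def sum_distrib_right[symmetric] by (simp only: mult_ac)
  then have "(\<Sum>v\<in>?V. walk_gf (edges G) ?V v) $ k = (\<Sum>i<vnum G. inverse (1 - fps_const (lam i) * fps_X)) $ k"
    unfolding inv by simp
  then show ?thesis unfolding root_moment_def fps_sum_nth fps_geometric by simp
qed

section \<open>Moments along a convergent sequence\<close>

lemma rooted_iso_sym:
  assumes "rooted_iso A B" "finite_rooted_graph A"
  shows "rooted_iso B A"
proof -
  obtain f where f: "bij_betw f (verts (fst A)) (verts (fst B))" "f (snd A) = snd B"
    and e: "\<And>u w. u \<in> verts (fst A) \<Longrightarrow> w \<in> verts (fst A) \<Longrightarrow>
         {u, w} \<in> edges (fst A) \<longleftrightarrow> {f u, f w} \<in> edges (fst B)"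
    using assms(1) unfolding rooted_iso_def by metis
  let ?g = "the_inv_into (verts (fst A)) f"
  have g: "bij_betw ?g (verts (fst B)) (verts (fst A))" by (rule bij_betw_the_inv_into[OF f(1)])
  have "?g (snd B) = snd A"
    using assms(2) f by (metis bij_betw_imp_inj_on finite_rooted_graph_def the_inv_into_f_f)
  moreover have "{u, w} \<in> edges (fst B) \<longleftrightarrow> {?g u, ?g w} \<in> edges (fst A)"
    if "u \<in> verts (fst B)" "w \<in> verts (fst B)" for u w
    using e[of "?g u" "?g w"] bij_betwE[OF g] that f_the_inv_into_f_bij_betw[OF f(1)] by auto
  ultimately show ?thesis unfolding rooted_iso_def using g by blast
qed

lemma rooted_iso_trans:
  assumes "rooted_iso A B" "rooted_iso B C"
  shows "rooted_iso A C"
proof -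
  obtain f where f: "bij_betw f (verts (fst A)) (verts (fst B))" "f (snd A) = snd B"
    and e: "\<And>u w. u \<in> verts (fst A) \<Longrightarrow> w \<in> verts (fst A) \<Longrightarrow>
         {u, w} \<in> edges (fst A) \<longleftrightarrow> {f u, f w} \<in> edges (fst B)"
    using assms(1) unfolding rooted_iso_def by metis
  obtain g where g: "bij_betw g (verts (fst B)) (verts (fst C))" "g (snd B) = snd C"
    and e': "\<And>u w. u \<in> verts (fst B) \<Longrightarrow> w \<in> verts (fst B) \<Longrightarrow>
         {u, w} \<in> edges (fst B) \<longleftrightarrow> {g u, g w} \<in> edges (fst C)"
    using assms(2) unfolding rooted_iso_def by metis
  show ?thesis unfolding rooted_iso_def
  proof (intro exI[of _ "g \<circ> f"] conjI ballI)
    show "bij_betw (g \<circ> f) (verts (fst A)) (verts (fst C))" by (rule bij_betw_trans[OF f(1) g(1)])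
    show "(g \<circ> f) (snd A) = snd C" using f g by simp
    fix u w assume "u \<in> verts (fst A)" "w \<in> verts (fst A)"
    then show "{u, w} \<in> edges (fst A) \<longleftrightarrow> {(g \<circ> f) u, (g \<circ> f) w} \<in> edges (fst C)"
      using e[of u w] e'[of "f u" "f w"] bij_betwE[OF f(1)] by simp
  qed
qed

text \<open>Initial segments as vertex sets keep this family finite while it still meets every
  isomorphism type with at most N vertices.\<close>

definition nat_rooted_graphs :: "nat \<Rightarrow> (nat ugraph \<times> nat) set" where
  "nat_rooted_graphs N = {A. finite_rooted_graph A \<and> (\<exists>m\<le>N. verts (fst A) = {..<m})}"

lemma finite_nat_rooted_graphs: "finite (nat_rooted_graphs N)"
proof (rule finite_subset)
  let ?F = "\<lambda>(m, E, r). (\<lparr>verts = {..<m}, edges = E\<rparr> :: nat ugraph, r)"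
  show "nat_rooted_graphs N \<subseteq> ?F ` ({..N} \<times> Pow (Pow {..<N}) \<times> {..<N})"
  proof
    fix A assume A: "A \<in> nat_rooted_graphs N"
    then obtain m where m: "m \<le> N" "verts (fst A) = {..<m}" unfolding nat_rooted_graphs_def by blast
    have "edges (fst A) \<subseteq> Pow {..<m}" "snd A < m"
      using A m(2) unfolding nat_rooted_graphs_def finite_rooted_graph_def finite_graph_def by auto
    then have "(m, edges (fst A), snd A) \<in> {..N} \<times> Pow (Pow {..<N}) \<times> {..<N}"
      using m(1) Pow_mono[of "{..<m}" "{..<N}"] by auto
    moreover have "A = ?F (m, edges (fst A), snd A)"
      using m(2) by (cases A) auto
    ultimately show "A \<in> ?F ` ({..N} \<times> Pow (Pow {..<N}) \<times> {..<N})" by (rule rev_image_eqI)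
  qed
qed auto

lemma ex_iso_nat_rooted_graph:
  assumes A: "finite_rooted_graph A" and N: "card (verts (fst A)) \<le> N"
  shows "\<exists>B\<in>nat_rooted_graphs N. rooted_iso A B"
proof -
  let ?V = "verts (fst A)"
  have G: "finite_graph (fst A)" and v: "snd A \<in> ?V" using A unfolding finite_rooted_graph_def by auto
  note g = finite_graphD[OF G]
  obtain h where h: "bij_betw h ?V {0..<card ?V}" using ex_bij_betw_finite_nat[OF g(2)] by blast
  have hV: "h u < card ?V" if "u \<in> ?V" for u using bij_betwE[OF h] that by auto
  have inj: "inj_on h ?V" by (rule bij_betw_imp_inj_on[OF h])
  define B where "B = (\<lparr>verts = {..<card ?V}, edges = (\<lambda>e. h ` e) ` edges (fst A)\<rparr>, h (snd A))"
  have "card (h ` e) = 2" if "e \<in> edges (fst A)" for e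
    using card_image[OF inj_on_subset[OF inj g(4)[OF that]]] g(1) that by simp
  moreover have "h ` e \<subseteq> {..<card ?V}" if "e \<in> edges (fst A)" for e
    using hV g(4)[OF that] by auto
  ultimately have "finite_rooted_graph B"
    using hV[OF v] unfolding finite_rooted_graph_def finite_graph_def B_def by auto
  then have "B \<in> nat_rooted_graphs N" using N unfolding nat_rooted_graphs_def B_def by auto
  moreover have "rooted_iso A B"
    unfolding rooted_iso_def
  proof (intro exI[of _ h] conjI ballI)
    show "bij_betw h (verts (fst A)) (verts (fst B))" using h unfolding B_def by (simp add: atLeast0LessThan)
    show "h (snd A) = snd B" unfolding B_def by simp
    fix u w assume uw: "u \<in> ?V" "w \<in> ?V"
    have "{u, w} = e" if "h ` e = h ` {u, w}" "e \<in> edges (fst A)" for e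
      using inj_on_image_eq_iff[OF inj g(4)[OF that(2)], of "{u, w}"] that(1) uw by simp
    moreover have "h ` {u, w} \<in> (`) h ` edges (fst A)" if "{u, w} \<in> edges (fst A)"
      using that by (rule imageI)
    ultimately show "{u, w} \<in> edges (fst A) \<longleftrightarrow> {h u, h w} \<in> edges (fst B)"
      unfolding B_def by auto
  qed
  ultimately show ?thesis by blast
qed

text \<open>Enlarging the radius by 1 replaces each vertex by its closed neighbourhood, which has at
  most d + 1 elements.\<close>

lemma card_ball_verts:
  assumes G: "finite_graph G" and d: "max_degree_le G d" and v: "v \<in> verts G"
  shows "card (ball_verts G v r) \<le> Suc d ^ r"
proof (induction r)
  case 0
  have "ball_verts G v 0 = {v}" unfolding ball_verts_def by auto
  then show ?case by simp
next
  case (Suc r)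
  let ?N = "\<lambda>u. insert u (nbhd (edges G) (verts G) u)"
  note g = finite_graphD[OF G]
  have fin: "finite (ball_verts G v r)" using ball_verts_subset[OF G v] g(2) finite_subset by blast
  have "ball_verts G v (Suc r) \<subseteq> (\<Union>u\<in>ball_verts G v r. ?N u)"
  proof
    fix w assume "w \<in> ball_verts G v (Suc r)"
    then obtain k where k: "k \<le> Suc r" "(v, w) \<in> adj_rel G ^^ k" unfolding ball_verts_def by blast
    show "w \<in> (\<Union>u\<in>ball_verts G v r. ?N u)"
    proof (cases "k \<le> r")
      case True
      then have "w \<in> ball_verts G v r" using k unfolding ball_verts_def by blast
      then show ?thesis by blast
    next
      case False
      then have "k = Suc r" using k(1) by simp
      then obtain u where u: "(v, u) \<in> adj_rel G ^^ r" "(u, w) \<in> adj_rel G" using k(2) by auto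
      then have "u \<in> ball_verts G v r" unfolding ball_verts_def by blast
      moreover have "w \<in> nbhd (edges G) (verts G) u"
        using u(2) g(4) unfolding adj_rel_def nbhd_def by auto
      ultimately show ?thesis by blast
    qed
  qed
  then have "card (ball_verts G v (Suc r)) \<le> card (\<Union>u\<in>ball_verts G v r. ?N u)"
    using fin finite_nbhd[OF g(2)] by (intro card_mono) auto
  also have "\<dots> \<le> (\<Sum>u\<in>ball_verts G v r. card (?N u))" by (rule card_UN_le[OF fin])
  also have "\<dots> \<le> (\<Sum>u\<in>ball_verts G v r. Suc d)"
  proof (rule sum_mono)
    fix u assume "u \<in> ball_verts G v r"
    then have "u \<in> verts G" using ball_verts_subset[OF G v] by blast
    then have "card (nbhd (edges G) (verts G) u) \<le> d"
      using card_nbhd_le_vdegree[OF G, of u] d unfolding max_degree_le_def by force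
    then show "card (?N u) \<le> Suc d"
      using card_insert_le_m1[of "Suc d" "nbhd (edges G) (verts G) u" u] by simp
  qed
  also have "\<dots> = Suc d * card (ball_verts G v r)" by simp
  also have "\<dots> \<le> Suc d ^ Suc r" unfolding power_Suc using Suc.IH by (rule mult_le_mono2)
  finally show ?case .
qed

text \<open>Uniqueness of the representative makes the ball types partition the vertices, so that
  averages over vertices become sums over R.\<close>

lemma ex_nat_rooted_representatives:
  "\<exists>R \<subseteq> nat_rooted_graphs N. \<forall>A :: 'a ugraph \<times> 'a.
     finite_rooted_graph A \<and> card (verts (fst A)) \<le> N \<longrightarrow> (\<exists>!B. B \<in> R \<and> rooted_iso A B)"
proof -
  \<comment> \<open>The predicate under \<open>SOME\<close> depends only on the isomorphism type of
    A, so c is constant on each type and its image has one element per type.\<close>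
  define c where "c A = (SOME B. B \<in> nat_rooted_graphs N \<and> rooted_iso A B)" for A :: "nat ugraph \<times> nat"
  have c: "c A \<in> nat_rooted_graphs N \<and> rooted_iso A (c A)" if "A \<in> nat_rooted_graphs N" for A
    unfolding c_def
  proof (rule someI_ex)
    have "rooted_iso A A" unfolding rooted_iso_def by (intro exI[of _ id]) auto
    then show "\<exists>B. B \<in> nat_rooted_graphs N \<and> rooted_iso A B" using that by blast
  qed
  have c_eq: "c A = c B" if "A \<in> nat_rooted_graphs N" "B \<in> nat_rooted_graphs N" "rooted_iso A B" for A B
  proof -
    have "rooted_iso B A" using rooted_iso_sym that unfolding nat_rooted_graphs_def by blast
    then have "rooted_iso A D \<longleftrightarrow> rooted_iso B D" for D :: "nat ugraph \<times> nat"
      using that(3) rooted_iso_trans by blast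
    then show ?thesis unfolding c_def by simp
  qed
  show ?thesis
  proof (intro exI[of _ "c ` nat_rooted_graphs N"] conjI allI impI)
    show "c ` nat_rooted_graphs N \<subseteq> nat_rooted_graphs N" using c by blast
    fix A :: "'a ugraph \<times> 'a" assume A: "finite_rooted_graph A \<and> card (verts (fst A)) \<le> N"
    then obtain B where B: "B \<in> nat_rooted_graphs N" "rooted_iso A B"
      using ex_iso_nat_rooted_graph by blast
    show "\<exists>!B. B \<in> c ` nat_rooted_graphs N \<and> rooted_iso A B"
    proof (rule ex1I[of _ "c B"])
      show "c B \<in> c ` nat_rooted_graphs N \<and> rooted_iso A (c B)"
        using B c[OF B(1)] rooted_iso_trans by blast
      fix D assume D: "D \<in> c ` nat_rooted_graphs N \<and> rooted_iso A D"
      then obtain D' where D': "D = c D'" "D' \<in> nat_rooted_graphs N" by blast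
      have "rooted_iso D' D" "finite_rooted_graph D'"
        using c[OF D'(2)] D' unfolding nat_rooted_graphs_def by auto
      then have "rooted_iso D D'" by (rule rooted_iso_sym)
      then have "rooted_iso A D'" using D rooted_iso_trans by blast
      moreover have "rooted_iso B A" using rooted_iso_sym[OF B(2)] A by blast
      ultimately have "rooted_iso B D'" using rooted_iso_trans by blast
      then show "D = c B" using c_eq[OF B(1) D'(2)] D' by simp
    qed
  qed
qed

text \<open>Sorting the vertices by the type of their ball writes the average as a finite linear
  combination of ball probabilities, with coefficients that do not depend on n.\<close>

lemma moments_convergent:
  fixes G :: "nat \<Rightarrow> 'a ugraph"
  assumes G: "\<And>n. finite_graph (G n)" and d: "\<And>n. max_degree_le (G n) d" and bs: "bs_convergent G"
  shows "convergent (\<lambda>n. (\<Sum>v\<in>verts (G n). root_moment (G n, v) k) / real (vnum (G n)))"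
proof -
  \<comment> \<open>N bounds the size of every ball of radius k + 1. That radius is taken instead of
    k because convergence is assumed for positive radii only and k may be 0.\<close>
  define N where "N = Suc d ^ Suc k"
  obtain R where R: "R \<subseteq> nat_rooted_graphs N" and ex1: "\<forall>A :: 'a ugraph \<times> 'a.
     finite_rooted_graph A \<and> card (verts (fst A)) \<le> N \<longrightarrow> (\<exists>!B. B \<in> R \<and> rooted_iso A B)"
    using ex_nat_rooted_representatives[of N, where ?'a = 'a] by (elim exE conjE) (rule that)
  have finR: "finite R" using R finite_nat_rooted_graphs finite_subset by blast
  have "(\<Sum>v\<in>verts (G n). root_moment (G n, v) k) / real (vnum (G n))
      = (\<Sum>A\<in>R. root_moment A k * ball_prob (G n) A (Suc k))" for n
  proof -
    let ?V = "verts (G n)" and ?b = "\<lambda>v. rooted_ball (G n) v (Suc k)"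
    note g = finite_graphD[OF G[of n]]
    have "(\<Sum>A\<in>R. root_moment A k * real (card {v \<in> ?V. rooted_iso (?b v) A}))
        = (\<Sum>A\<in>R. \<Sum>v | v \<in> ?V \<and> rooted_iso (?b v) A. root_moment A k)"
      by (simp add: mult.commute)
    also have "\<dots> = (\<Sum>v\<in>?V. \<Sum>A | A \<in> R \<and> rooted_iso (?b v) A. root_moment A k)"
      by (rule sum.swap_restrict[OF finR g(2)])
    also have "\<dots> = (\<Sum>v\<in>?V. root_moment (G n, v) k)"
    proof (rule sum.cong)
      fix v assume v: "v \<in> ?V"
      have fb: "finite_rooted_graph (?b v)" by (rule rooted_ball_finite[OF G v])
      have cb: "card (verts (fst (?b v))) \<le> N"
        using card_ball_verts[OF G d v, of "Suc k"] unfolding N_def rooted_ball_def induced_subgraph_def by simp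
      obtain B where B: "B \<in> R" "rooted_iso (?b v) B"
        and uniq: "\<And>A. A \<in> R \<and> rooted_iso (?b v) A \<Longrightarrow> A = B"
        using ex1[rule_format, OF conjI[OF fb cb]] by (elim ex1E conjE) blast
      have "{A. A \<in> R \<and> rooted_iso (?b v) A} = {B}" using B uniq by blast
      moreover have "root_moment (?b v) k = root_moment B k"
        using B R by (intro root_moment_iso[OF fb]) (auto simp: nat_rooted_graphs_def)
      ultimately show "(\<Sum>A | A \<in> R \<and> rooted_iso (?b v) A. root_moment A k) = root_moment (G n, v) k"
        using root_moment_ball[OF G v, of k "Suc k"] by simp
    qed simp
    finally have sum: "(\<Sum>A\<in>R. root_moment A k * real (card {v \<in> ?V. rooted_iso (?b v) A}))
      = (\<Sum>v\<in>?V. root_moment (G n, v) k)" .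
    have bp: "ball_prob (G n) A (Suc k) = real (card {v \<in> ?V. rooted_iso (?b v) A}) / real (vnum (G n))"
      for A :: "nat ugraph \<times> nat"
      unfolding ball_prob_def vnum_def
      by (subst measure_pmf_of_set) (use g(2,3) in \<open>auto simp: vnum_def Int_def card_gt_0_iff\<close>)
    show ?thesis
      unfolding bp times_divide_eq_right sum_divide_distrib[symmetric] sum ..
  qed
  moreover have "convergent (\<lambda>n. \<Sum>A\<in>R. root_moment A k * ball_prob (G n) A (Suc k))"
  proof (rule convergent_sum)
    fix A assume "A \<in> R"
    then have "finite_rooted_graph A" using R unfolding nat_rooted_graphs_def by blast
    then have "convergent (\<lambda>n. ball_prob (G n) A (Suc k))"
      using bs unfolding bs_convergent_def by blast
    then show "convergent (\<lambda>n. root_moment A k * ball_prob (G n) A (Suc k))"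
      by (intro convergent_mult convergent_const)
  qed
  ultimately show ?thesis by simp
qed

section \<open>Matching parameters in terms of roots\<close>

lemma integral_matching_measure:
  fixes f :: "real \<Rightarrow> real"
  assumes lam: "graph_roots G lam" and f: "f \<in> borel_measurable borel"
  shows "integral\<^sup>L (matching_measure G) f = (\<Sum>i<vnum G. f (lam i)) / real (vnum G)"
proof -
  have n: "{..<vnum G} \<noteq> {}" using lam finite_graphD(3)[of G] unfolding graph_roots_def by auto
  show ?thesis
    unfolding matching_measure_eq[OF lam] using f n
    by (simp add: integral_distr integral_pmf_of_set)
qed

lemma real_distribution_matching_measure: "real_distribution (matching_measure G)"
  unfolding matching_measure_def
  by (rule prob_space.real_distribution_distr) (auto intro: measure_pmf.prob_space_axioms)

lemma AE_matching_measure: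
  assumes lam: "graph_roots G lam" and d: "d \<ge> 2" "max_degree_le G d"
  shows "AE x in matching_measure G. \<bar>x\<bar> \<le> 2 * sqrt (real d - 1)"
proof -
  have n: "{..<vnum G} \<noteq> {}" using lam finite_graphD(3)[of G] unfolding graph_roots_def by auto
  show ?thesis
    unfolding matching_measure_eq[OF lam] using graph_roots_bound[OF lam d] n
    by (subst AE_distr_iff) (auto simp: AE_measure_pmf_iff)
qed

section \<open>The matching generating function and its logarithmic derivatives\<close>

lemma hmp_one_eq:
  fixes t :: "'b::comm_semiring_1"
  assumes G: "finite_graph G"
  shows "hmp (edges G) (verts G) 1 t = (\<Sum>M\<in>matchings G. t ^ card M)"
  unfolding hmp_def matchings_eq[OF G] by simp

lemma finite_matchings:
  assumes G: "finite_graph G"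
  shows "finite (matchings G)" "{} \<in> matchings G" "matchings G \<noteq> {}"
proof -
  show "finite (matchings G)"
    unfolding matchings_eq[OF G] by (rule finite_matchings_in[OF finite_graphD(2)[OF G]])
  show "{} \<in> matchings G" unfolding matchings_def by (auto simp: disjoint_def)
  then show "matchings G \<noteq> {}" by blast
qed

lemma matching_sum_pos:
  assumes G: "finite_graph G" and t: "t > (0::real)"
  shows "(\<Sum>M\<in>matchings G. t ^ card M) > 0"
  by (rule sum_pos) (use finite_matchings[OF G] t in auto)

text \<open>Half the logarithm of \<open>hmp_square\<close>. The variable t is kept so that
  differentiation can give the mean and then the variance.\<close>

lemma ln_matching_sum:
  assumes lam: "graph_roots G lam" and t: "t > 0"
  shows "ln (\<Sum>M\<in>matchings G. t ^ card M) = (\<Sum>i<vnum G. ln (1 + t * lam i ^ 2)) / 2"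
proof -
  have G: "finite_graph G" using lam unfolding graph_roots_def by blast
  have pos: "1 + t * lam i ^ 2 > 0" for i using t by (simp add: add_pos_nonneg)
  then have nz: "1 + t * lam i ^ 2 \<noteq> 0" for i by (metis less_irrefl)
  have "2 * ln (\<Sum>M\<in>matchings G. t ^ card M) = ln ((\<Sum>M\<in>matchings G. t ^ card M) ^ 2)"
    using matching_sum_pos[OF G t] by (simp add: ln_realpow)
  also have "\<dots> = (\<Sum>i<vnum G. ln (1 + t * lam i ^ 2))"
    unfolding hmp_one_eq[OF G, symmetric] hmp_square[OF lam] using nz
    by (intro ln_prod) auto
  finally show ?thesis by simp
qed

lemma matching_sum_log_deriv:
  assumes lam: "graph_roots G lam" and t: "t > 0"
  shows "(\<Sum>M\<in>matchings G. real (card M) * t ^ card M) / (\<Sum>M\<in>matchings G. t ^ card M)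
    = (\<Sum>i<vnum G. t * lam i ^ 2 / (1 + t * lam i ^ 2)) / 2"
proof -
  have G: "finite_graph G" using lam unfolding graph_roots_def by blast
  let ?P = "\<lambda>t. \<Sum>M\<in>matchings G. t ^ card M :: real"
  let ?P' = "\<Sum>M\<in>matchings G. real (card M) * t ^ (card M - 1)"
  have Pt: "?P t > 0" by (rule matching_sum_pos[OF G t])
  have pos: "1 + t * lam i ^ 2 > 0" for i using t by (simp add: add_pos_nonneg)
  then have nz: "1 + t * lam i ^ 2 \<noteq> 0" for i by (metis less_irrefl)
  have "((\<lambda>t. ln (?P t)) has_real_derivative ?P' / ?P t) (at t)"
    using Pt by (auto intro!: derivative_eq_intros sum.cong)
  moreover have "((\<lambda>t. (\<Sum>i<vnum G. ln (1 + t * lam i ^ 2)) / 2) has_real_derivative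
      (\<Sum>i<vnum G. lam i ^ 2 / (1 + t * lam i ^ 2)) / 2) (at t)"
    using pos nz by (auto intro!: derivative_eq_intros sum.cong)
  \<comment> \<open>\<open>ln_matching_sum\<close> is available for positive t, hence the transfer
    of the derivative on the open half-line.\<close>
  then have "((\<lambda>t. ln (?P t)) has_real_derivative
      (\<Sum>i<vnum G. lam i ^ 2 / (1 + t * lam i ^ 2)) / 2) (at t)"
    by (rule has_field_derivative_transform_within_open[of _ _ _ "{0<..}"])
       (use t ln_matching_sum[OF lam] in auto)
  ultimately have "?P' / ?P t = (\<Sum>i<vnum G. lam i ^ 2 / (1 + t * lam i ^ 2)) / 2"
    by (rule DERIV_unique)
  then have "t * ?P' / ?P t = t * (\<Sum>i<vnum G. lam i ^ 2 / (1 + t * lam i ^ 2)) / 2"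
    by (simp only: times_divide_eq_right[symmetric])
  moreover have "t * ?P' = (\<Sum>M\<in>matchings G. real (card M) * t ^ card M)"
    unfolding sum_distrib_left
  proof (rule sum.cong)
    \<comment> \<open>For the empty matching the exponent truncates, but the factor
      \<open>real (card M)\<close> vanishes.\<close>
    fix M show "t * (real (card M) * t ^ (card M - 1)) = real (card M) * t ^ card M"
      by (cases "card M") auto
  qed simp
  ultimately show ?thesis by (simp add: sum_distrib_left)
qed

lemma expected_matching_size_eq:
  assumes lam: "graph_roots G lam"
  shows "expected_matching_size G = (\<Sum>i<vnum G. lam i ^ 2 / (1 + lam i ^ 2)) / 2"
proof -
  have G: "finite_graph G" using lam unfolding graph_roots_def by blast
  have "expected_matching_size G = (\<Sum>M\<in>matchings G. real (card M)) / real (card (matchings G))"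
    unfolding expected_matching_size_def random_matching_size_def integral_map_pmf
    by (rule integral_pmf_of_set) (use finite_matchings[OF G] in auto)
  then show ?thesis using matching_sum_log_deriv[OF lam, of 1] by simp
qed

lemma variance_matching_size_eq:
  assumes lam: "graph_roots G lam"
  shows "variance_matching_size G = (\<Sum>i<vnum G. lam i ^ 2 / (1 + lam i ^ 2) ^ 2) / 2"
proof -
  have G: "finite_graph G" using lam unfolding graph_roots_def by blast
  note fin = finite_matchings[OF G]
  let ?A = "matchings G" and ?c = "\<lambda>M. real (card M)"
  define N where "N = real (card ?A)"
  have N: "N > 0" using fin unfolding N_def by (simp add: card_gt_0_iff)
  define e where "e = (\<Sum>M\<in>?A. ?c M) / N"
  have e: "expected_matching_size G = e"
    unfolding expected_matching_size_def random_matching_size_def integral_map_pmf e_def N_def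
    by (rule integral_pmf_of_set) (use fin in auto)
  have "variance_matching_size G = (\<Sum>M\<in>?A. (?c M - e) ^ 2) / N"
    unfolding variance_matching_size_def e[unfolded expected_matching_size_def]
    unfolding random_matching_size_def integral_map_pmf N_def
    by (rule integral_pmf_of_set) (use fin in auto)
  also have "(\<Sum>M\<in>?A. (?c M - e) ^ 2) = (\<Sum>M\<in>?A. ?c M ^ 2) - 2 * e * (\<Sum>M\<in>?A. ?c M) + N * e ^ 2"
    by (simp add: power2_diff sum.distrib sum_subtractf sum_distrib_left N_def mult_ac)
  also have "(\<Sum>M\<in>?A. ?c M) = N * e" unfolding e_def using N by simp
  also have "((\<Sum>M\<in>?A. ?c M ^ 2) - 2 * e * (N * e) + N * e ^ 2) / N
      = ((\<Sum>M\<in>?A. ?c M ^ 2) * N - (N * e) * (N * e)) / (N * N)"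
    using N by (simp add: field_simps power2_eq_square)
  finally have var: "variance_matching_size G = ((\<Sum>M\<in>?A. ?c M ^ 2) * N - (\<Sum>M\<in>?A. ?c M) * (\<Sum>M\<in>?A. ?c M)) / (N * N)"
    unfolding e_def using N by simp
  let ?P = "\<lambda>t. \<Sum>M\<in>?A. t ^ card M :: real" and ?Q = "\<lambda>t. \<Sum>M\<in>?A. ?c M * t ^ card M"
  have P1: "?P 1 = N" "?Q 1 = (\<Sum>M\<in>?A. ?c M)" unfolding N_def by auto
  have dP: "(?P has_real_derivative (\<Sum>M\<in>?A. ?c M)) (at 1)"
    by (auto intro!: derivative_eq_intros sum.cong)
  have dQ: "(?Q has_real_derivative (\<Sum>M\<in>?A. ?c M ^ 2)) (at 1)"
    by (auto intro!: derivative_eq_intros sum.cong simp: power2_eq_square)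
  \<comment> \<open>The variance is the derivative at 1 of the mean under weights t^|M|: as P(1) = N
    and P'(1) = Q(1), the quotient rule gives the second moment minus the squared mean.\<close>
  have "((\<lambda>t. ?Q t / ?P t) has_real_derivative variance_matching_size G) (at 1)"
    unfolding var using DERIV_divide[OF dQ dP] N P1 by simp
  moreover have pos: "1 + lam i ^ 2 > 0" for i by (simp add: add_pos_nonneg)
  have "((\<lambda>t. (\<Sum>i<vnum G. t * lam i ^ 2 / (1 + t * lam i ^ 2)) / 2) has_real_derivative
      (\<Sum>i<vnum G. lam i ^ 2 / (1 + lam i ^ 2) ^ 2) / 2) (at 1)"
    using pos by (auto intro!: derivative_eq_intros sum.cong simp: less_imp_neq[THEN not_sym] algebra_simps power2_eq_square)
  then have "((\<lambda>t. ?Q t / ?P t) has_real_derivative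
      (\<Sum>i<vnum G. lam i ^ 2 / (1 + lam i ^ 2) ^ 2) / 2) (at 1)"
    by (rule has_field_derivative_transform_within_open[of _ _ _ "{0<..}"])
       (use matching_sum_log_deriv[OF lam] in auto)
  ultimately show ?thesis by (rule DERIV_unique)
qed

text \<open>Degrees and leading coefficients are compared in \<open>hmp_square_poly\<close>. The
  left side has degree twice the matching number and leading coefficient the square of the number of
  maximum matchings; on the right a factor is linear for a nonzero root and the constant 1 for the
  root 0.\<close>

lemma
  assumes lam: "graph_roots G lam"
  shows card_nonzero_roots: "card {i. i < vnum G \<and> lam i \<noteq> 0} = 2 * matching_number G"
    and prod_nonzero_roots: "(\<Prod>i | i < vnum G \<and> lam i \<noteq> 0. lam i ^ 2)
      = real (num_matchings_of_size G (matching_number G)) ^ 2"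
    and num_matchings_of_max_size: "num_matchings_of_size G (matching_number G) \<ge> 1"
proof -
  have G: "finite_graph G" using lam unfolding graph_roots_def by blast
  note fin = finite_matchings[OF G]
  define P where "P = (hmp (edges G) (verts G) 1 [:0, 1:] :: real poly)"
  have "P = (\<Sum>M\<in>matchings G. monom 1 (card M))"
    unfolding P_def hmp_one_eq[OF G] by (simp add: monom_altdef)
  then have cP: "coeff P k = real (num_matchings_of_size G k)" for k
    using fin by (simp add: coeff_sum num_matchings_of_size_def Int_def flip: sum.inter_filter)
  let ?\<nu> = "matching_number G"
  have "?\<nu> \<in> card ` matchings G" unfolding matching_number_def using fin by (intro Max_in) auto
  then obtain M where M: "M \<in> matchings G" "card M = ?\<nu>" by auto
  then have "M \<in> {M \<in> matchings G. card M = ?\<nu>}" by simp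
  then have "card {M \<in> matchings G. card M = ?\<nu>} > 0" using fin by (auto simp: card_gt_0_iff)
  then show ge1: "num_matchings_of_size G ?\<nu> \<ge> 1" unfolding num_matchings_of_size_def by simp
  have "{M \<in> matchings G. card M = k} = {}" if "k > ?\<nu>" for k
    using that fin Max_ge[of "card ` matchings G"] unfolding matching_number_def by fastforce
  then have "coeff P k = 0" if "k > ?\<nu>" for k
    using that unfolding cP num_matchings_of_size_def by (metis card.empty of_nat_0)
  then have "degree P \<le> ?\<nu>" by (intro degree_le) auto
  moreover have "coeff P ?\<nu> \<noteq> 0" using ge1 unfolding cP by simp
  ultimately have dP: "degree P = ?\<nu>" using le_degree by (metis le_antisym)
  have P0: "P \<noteq> 0" using \<open>coeff P ?\<nu> \<noteq> 0\<close> by auto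
  have sq: "P ^ 2 = (\<Prod>i<vnum G. [:1, lam i ^ 2:])" unfolding P_def by (rule hmp_square_poly[OF lam])
  have "degree (P ^ 2) = (\<Sum>i<vnum G. degree [:1, lam i ^ 2:])"
    unfolding sq by (rule degree_prod_eq_sum_degree) auto
  also have "\<dots> = (\<Sum>i<vnum G. if lam i \<noteq> 0 then 1 else 0)"
    by (rule sum.cong) auto
  also have "\<dots> = card {i. i < vnum G \<and> lam i \<noteq> 0}"
    by (simp add: sum.If_cases Int_def)
  finally show "card {i. i < vnum G \<and> lam i \<noteq> 0} = 2 * ?\<nu>"
    using dP P0 by (simp add: degree_power_eq)
  have "lead_coeff (P ^ 2) = (\<Prod>i<vnum G. lead_coeff [:1, lam i ^ 2:])"
    unfolding sq by (rule lead_coeff_prod)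
  also have "\<dots> = (\<Prod>i<vnum G. if lam i \<noteq> 0 then lam i ^ 2 else 1)"
    by (rule prod.cong) auto
  also have "\<dots> = (\<Prod>i | i < vnum G \<and> lam i \<noteq> 0. lam i ^ 2)"
    by (simp add: prod.If_cases Int_def)
  finally show "(\<Prod>i | i < vnum G \<and> lam i \<noteq> 0. lam i ^ 2) = real (num_matchings_of_size G ?\<nu>) ^ 2"
    unfolding lead_coeff_power dP cP by simp
qed

lemma sum_ln_nonzero_roots:
  assumes lam: "graph_roots G lam"
  shows "(\<Sum>i | i < vnum G \<and> lam i \<noteq> 0. ln \<bar>lam i\<bar>)
    = ln (real (num_matchings_of_size G (matching_number G)))"
proof -
  let ?I = "{i. i < vnum G \<and> lam i \<noteq> 0}"
  let ?m = "real (num_matchings_of_size G (matching_number G))"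
  have "2 * ln \<bar>x\<bar> = ln (x ^ 2)" if "x \<noteq> 0" for x :: real
    using ln_realpow[of "\<bar>x\<bar>" 2] that by simp
  then have "2 * (\<Sum>i\<in>?I. ln \<bar>lam i\<bar>) = (\<Sum>i\<in>?I. ln (lam i ^ 2))"
    unfolding sum_distrib_left by (intro sum.cong) simp_all
  also have "\<dots> = ln (\<Prod>i\<in>?I. lam i ^ 2)" by (rule ln_prod[symmetric]) auto
  also have "\<dots> = 2 * ln ?m"
    unfolding prod_nonzero_roots[OF lam] using num_matchings_of_max_size[OF lam]
    by (simp add: ln_realpow)
  finally show ?thesis by simp
qed

text \<open>Lueck's argument: the product of the nonzero roots is at least 1 in absolute value, so only few of
  them can be small.\<close>

lemma card_small_roots:
  assumes lam: "graph_roots G lam" and \<omega>: "\<And>i. i < vnum G \<Longrightarrow> \<bar>lam i\<bar> \<le> \<omega>" "\<omega> \<ge> 1"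
    and m: "m > 0"
  shows "m * real (card {i. i < vnum G \<and> 0 < \<bar>lam i\<bar> \<and> \<bar>lam i\<bar> < exp (- m)}) \<le> real (vnum G) * ln \<omega>"
proof -
  let ?I = "{i. i < vnum G \<and> lam i \<noteq> 0}" and ?J = "{i. i < vnum G \<and> 0 < \<bar>lam i\<bar> \<and> \<bar>lam i\<bar> < exp (- m)}"
  \<comment> \<open>The sum is the logarithm of an integer that is at least 1. Small roots
    contribute at most -m each and the others at most ln \<omega>, so there cannot be many small
    ones.\<close>
  have "0 \<le> (\<Sum>i\<in>?I. ln \<bar>lam i\<bar>)"
    unfolding sum_ln_nonzero_roots[OF lam] using num_matchings_of_max_size[OF lam] by simp
  also have "\<dots> \<le> (\<Sum>i\<in>?I. if i \<in> ?J then - m else ln \<omega>)"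
  proof (rule sum_mono)
    fix i assume i: "i \<in> ?I"
    have "ln \<bar>lam i\<bar> \<le> - m" if "i \<in> ?J"
      using that i ln_le_cancel_iff[of "\<bar>lam i\<bar>" "exp (- m)"] by auto
    moreover have "ln \<bar>lam i\<bar> \<le> ln \<omega>" using i \<omega> by auto
    ultimately show "ln \<bar>lam i\<bar> \<le> (if i \<in> ?J then - m else ln \<omega>)" by auto
  qed
  also have "\<dots> = - m * real (card ?J) + real (card (?I - ?J)) * ln \<omega>"
  proof -
    have "?I \<inter> {i. i \<in> ?J} = ?J" "?I \<inter> - {i. i \<in> ?J} = ?I - ?J" by auto
    then show ?thesis by (subst sum.If_cases) simp_all
  qed
  also have "\<dots> \<le> - m * real (card ?J) + real (vnum G) * ln \<omega>"
  proof -
    have "card (?I - ?J) \<le> card {..<vnum G}" by (rule card_mono) auto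
    then show ?thesis using \<omega>(2) by (intro add_left_mono mult_right_mono) auto
  qed
  finally show ?thesis by simp
qed

text \<open>A matching is perfect exactly if twice its size is the number of vertices; as no
  matching is larger, the perfect matchings are then the maximum ones.\<close>

lemma perfect_matchings_eq:
  assumes G: "finite_graph G" and pm: "num_perfect_matchings G > 0"
  shows "2 * matching_number G = vnum G"
    and "num_perfect_matchings G = num_matchings_of_size G (matching_number G)"
proof -
  note fin = finite_matchings[OF G] and g = finite_graphD[OF G]
  have U: "card (\<Union>M) = 2 * card M" "\<Union>M \<subseteq> verts G" "2 * card M \<le> vnum G" if "M \<in> matchings G" for M
    using that card_Union_matching[OF g(1)] card_matching_le[OF g(1,2)]
    unfolding matchings_eq[OF G] by (auto simp: matchings_in_def vnum_def)
  have perf: "\<Union>M = verts G \<longleftrightarrow> 2 * card M = vnum G" if "M \<in> matchings G" for M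
    using U[OF that] card_subset_eq[OF g(2)] unfolding vnum_def by metis
  have "{M \<in> matchings G. \<Union>M = verts G} \<noteq> {}"
    using pm unfolding num_perfect_matchings_def by (metis card.empty less_irrefl)
  then obtain M where M: "M \<in> matchings G" "2 * card M = vnum G" using perf by blast
  have "matching_number G = card M"
    unfolding matching_number_def
    by (rule Max_eqI) (use fin M U(3) in fastforce)+
  then show "2 * matching_number G = vnum G" using M by simp
  then have "\<Union>M = verts G \<longleftrightarrow> card M = matching_number G" if "M \<in> matchings G" for M
    using perf[OF that] by arith
  then show "num_perfect_matchings G = num_matchings_of_size G (matching_number G)"
    unfolding num_perfect_matchings_def num_matchings_of_size_def
    by (intro arg_cong[of _ _ card] Collect_cong conj_cong) auto
qed

lemma ln_perfect_matchings:
  assumes lam: "graph_roots G lam" and pm: "num_perfect_matchings G > 0"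
  shows "ln (real (num_perfect_matchings G)) = (\<Sum>i<vnum G. ln \<bar>lam i\<bar>)"
    and "\<And>i. i < vnum G \<Longrightarrow> lam i \<noteq> 0"
proof -
  have G: "finite_graph G" using lam unfolding graph_roots_def by blast
  let ?I = "{i. i < vnum G \<and> lam i \<noteq> 0}"
  have "card ?I = card {..<vnum G}"
    using card_nonzero_roots[OF lam] perfect_matchings_eq(1)[OF G pm] by simp
  then have I: "?I = {..<vnum G}" by (intro card_subset_eq) auto
  then show "\<And>i. i < vnum G \<Longrightarrow> lam i \<noteq> 0" by blast
  show "ln (real (num_perfect_matchings G)) = (\<Sum>i<vnum G. ln \<bar>lam i\<bar>)"
    using sum_ln_nonzero_roots[OF lam] unfolding I perfect_matchings_eq(2)[OF G pm] by simp
qed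

section \<open>Weak limits of measures with bounded support\<close>

text \<open>On a bounded support the Taylor polynomials approximate the characteristic functions
  uniformly in n, so convergence of moments makes the characteristic functions converge pointwise.
  Tightness yields a limit along a subsequence, and Levy's theorem extends it to the whole
  sequence.\<close>

lemma ex_weak_limit_of_moments:
  fixes \<mu> :: "nat \<Rightarrow> real measure"
  assumes \<mu>: "\<And>n. real_distribution (\<mu> n)" and supp: "\<And>n. AE x in \<mu> n. \<bar>x\<bar> \<le> \<omega>" and \<omega>: "\<omega> \<ge> 0"
    and mom: "\<And>k. convergent (\<lambda>n. \<integral>x. x ^ k \<partial>\<mu> n)"
  shows "\<exists>\<rho>. real_distribution \<rho> \<and> weak_conv_m \<mu> \<rho>"
proof -
  have pow: "integrable (\<mu> n) (\<lambda>x. x ^ k)" "(\<integral>x. \<bar>x\<bar> ^ k \<partial>\<mu> n) \<le> \<omega> ^ k" for n k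
  proof -
    interpret real_distribution "\<mu> n" by (rule \<mu>)
    have le: "AE x in \<mu> n. \<bar>x\<bar> ^ k \<le> \<omega> ^ k"
      using supp[of n] by eventually_elim (auto intro: power_mono)
    then show "integrable (\<mu> n) (\<lambda>x. x ^ k)"
      by (intro integrable_const_bound[where B = "\<omega> ^ k"]) (auto simp: power_abs)
    then have "integrable (\<mu> n) (\<lambda>x. \<bar>x\<bar> ^ k)" by (subst power_abs[symmetric]) (rule integrable_abs)
    then have "(\<integral>x. \<bar>x\<bar> ^ k \<partial>\<mu> n) \<le> (\<integral>x. \<omega> ^ k \<partial>\<mu> n)"
      by (rule integral_mono_AE[OF _ _ le]) simp
    then show "(\<integral>x. \<bar>x\<bar> ^ k \<partial>\<mu> n) \<le> \<omega> ^ k" using prob_space by simp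
  qed
  have char: "convergent (\<lambda>n. char (\<mu> n) t)" for t
  proof (rule Cauchy_convergent, rule metric_CauchyI)
    fix e :: real assume e: "e > 0"
    \<comment> \<open>This is the Taylor error bound of order N; it is the same for all n and tends
      to 0 as the general term of an exponential series.\<close>
    have lim: "(\<lambda>N. 2 * (inverse (fact N) * (\<bar>t\<bar> * \<omega>) ^ N)) \<longlonglongrightarrow> 2 * 0"
      using summable_LIMSEQ_zero[OF summable_exp[of "\<bar>t\<bar> * \<omega>"]] by (intro tendsto_mult tendsto_const)
    have "eventually (\<lambda>N. 2 * (inverse (fact N) * (\<bar>t\<bar> * \<omega>) ^ N) < e / 3) sequentially"
      using e by (intro order_tendstoD(2)[OF lim]) simp
    then obtain N where N: "2 * (inverse (fact N) * (\<bar>t\<bar> * \<omega>) ^ N) < e / 3"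
      by (auto simp: eventually_sequentially)
    define p where "p n = (\<Sum>k\<le>N. ((\<i> * t) ^ k / fact k) * complex_of_real (\<integral>x. x ^ k \<partial>\<mu> n))" for n
    have cp: "cmod (char (\<mu> n) t - p n) < e / 3" for n
    proof -
      interpret real_distribution "\<mu> n" by (rule \<mu>)
      have "cmod (char (\<mu> n) t - p n) \<le> (2 * \<bar>t\<bar> ^ N / fact N) * (\<integral>x. \<bar>x\<bar> ^ N \<partial>\<mu> n)"
        unfolding p_def by (rule char_approx1) (rule pow)
      also have "\<dots> \<le> (2 * \<bar>t\<bar> ^ N / fact N) * \<omega> ^ N"
        by (intro mult_left_mono pow) auto
      also have "\<dots> < e / 3" using N by (simp add: power_mult_distrib field_simps)
      finally show ?thesis .
    qed
    have "convergent (\<lambda>n. complex_of_real (\<integral>x. x ^ k \<partial>\<mu> n))" for k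
      using mom[of k] unfolding convergent_def by (elim exE) (rule exI, erule tendsto_of_real)
    then have "convergent p"
      unfolding p_def by (intro convergent_sum convergent_mult convergent_const)
    then obtain n0 where n0: "\<And>m n. m \<ge> n0 \<Longrightarrow> n \<ge> n0 \<Longrightarrow> dist (p m) (p n) < e / 3"
      using metric_CauchyD[OF convergent_Cauchy, of p "e / 3"] e by auto
    show "\<exists>M. \<forall>m\<ge>M. \<forall>n\<ge>M. dist (char (\<mu> m) t) (char (\<mu> n) t) < e"
    proof (intro exI allI impI)
      fix m n assume mn: "m \<ge> n0" "n \<ge> n0"
      have "dist (char (\<mu> m) t) (char (\<mu> n) t) \<le>
          dist (char (\<mu> m) t) (p m) + dist (p m) (p n) + dist (p n) (char (\<mu> n) t)"
        using dist_triangle[of "char (\<mu> m) t" "char (\<mu> n) t" "p m"] dist_triangle[of "p m" "char (\<mu> n) t" "p n"]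
        by linarith
      also have "\<dots> < e / 3 + e / 3 + e / 3"
        using cp[of m] cp[of n] n0[OF mn] by (intro add_strict_mono) (auto simp: dist_norm norm_minus_commute)
      finally show "dist (char (\<mu> m) t) (char (\<mu> n) t) < e" by simp
    qed
  qed
  have "tight \<mu>"
    unfolding tight_def
  proof (intro conjI allI impI)
    fix e :: real assume e: "e > 0"
    \<comment> \<open>Tightness is phrased with intervals open on the left, so the support is
      enlarged by 1, which also keeps the interval nondegenerate for \<omega> = 0.\<close>
    have "measure (\<mu> n) {- \<omega> - 1<..\<omega> + 1} = 1" for n
    proof -
      interpret real_distribution "\<mu> n" by (rule \<mu>)
      show ?thesis using supp[of n] by (subst prob_eq_1) (auto elim: eventually_mono)
    qed
    then have "- \<omega> - 1 < \<omega> + 1 \<and> (\<forall>n. measure (\<mu> n) {- \<omega> - 1<..\<omega> + 1} > 1 - e)" using e \<omega> by auto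
    then show "\<exists>a b. a < b \<and> (\<forall>n. measure (\<mu> n) {a<..b} > 1 - e)" by blast
  qed (rule \<mu>)
  then obtain r M where r: "strict_mono r" and M: "real_distribution M"
    and conv: "weak_conv_m (\<mu> \<circ> id \<circ> r) M"
    using tight_imp_convergent_subsubsequence[of \<mu> id] strict_mono_id by metis
  \<comment> \<open>The whole sequence is known to converge, so its limit is the one found along the
    subsequence.\<close>
  have "(\<lambda>n. char (\<mu> n) t) \<longlonglongrightarrow> char M t" for t
  proof -
    obtain L where L: "(\<lambda>n. char (\<mu> n) t) \<longlonglongrightarrow> L" using char unfolding convergent_def by blast
    have "(\<lambda>n. char ((\<mu> \<circ> id \<circ> r) n) t) \<longlonglongrightarrow> char M t"
      by (rule levy_continuity1[OF _ M conv]) (simp add: \<mu>)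
    moreover have "(\<lambda>n. char ((\<mu> \<circ> id \<circ> r) n) t) \<longlonglongrightarrow> L"
      using LIMSEQ_subseq_LIMSEQ[OF L r] by (simp add: o_def)
    ultimately show ?thesis using L LIMSEQ_unique by blast
  qed
  then have "weak_conv_m \<mu> M" by (rule levy_continuity[OF \<mu> M])
  then show ?thesis using M by blast
qed

text \<open>The support condition is imposed on the approximating measures; the limit inherits it in
  \<open>AE_limit\<close>. The bound on \<omega> keeps ln \<omega> nonnegative.\<close>

locale weak_limit =
  fixes \<mu> :: "nat \<Rightarrow> real measure" and \<rho> :: "real measure" and \<omega> :: real
  assumes \<mu>: "\<And>n. real_distribution (\<mu> n)" and \<rho>: "real_distribution \<rho>"
    and supp: "\<And>n. AE x in \<mu> n. \<bar>x\<bar> \<le> \<omega>" and \<omega>: "\<omega> \<ge> 1"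
    and conv: "weak_conv_m \<mu> \<rho>"
begin

sublocale \<rho>: real_distribution \<rho> by (rule \<rho>)

lemma tendsto_bounded_integral:
  fixes f :: "real \<Rightarrow> real"
  assumes "\<And>x. isCont f x" "\<And>x. \<bar>f x\<bar> \<le> B"
  shows "(\<lambda>n. integral\<^sup>L (\<mu> n) f) \<longlonglongrightarrow> integral\<^sup>L \<rho> f"
  by (rule weak_conv_imp_integral_bdd_continuous_conv[OF \<mu> \<rho> conv]) (use assms in auto)

lemma AE_limit: "AE x in \<rho>. \<bar>x\<bar> \<le> \<omega>"
proof -
  \<comment> \<open>A bounded continuous function that vanishes exactly on the interval, so its zero
    integrals pass to the limit.\<close>
  let ?g = "\<lambda>x. min 1 (max 0 (\<bar>x\<bar> - \<omega>))"
  have m: "?g \<in> borel_measurable borel" by measurable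
  have "(\<lambda>n. integral\<^sup>L (\<mu> n) ?g) \<longlonglongrightarrow> integral\<^sup>L \<rho> ?g"
    by (rule tendsto_bounded_integral[where B = 1]) (auto intro!: continuous_intros)
  moreover have "integral\<^sup>L (\<mu> n) ?g = 0" for n
  proof (rule integral_eq_zero_AE)
    show "AE x in \<mu> n. ?g x = 0" using supp[of n] by eventually_elim auto
  qed
  ultimately have "integral\<^sup>L \<rho> ?g = 0" using LIMSEQ_unique[OF _ tendsto_const] by fastforce
  moreover have "integrable \<rho> ?g"
    by (rule \<rho>.integrable_const_bound[where B = 1]) (use m in auto)
  ultimately have "AE x in \<rho>. ?g x = 0"
    by (subst (asm) integral_nonneg_eq_0_iff_AE) auto
  then show ?thesis by eventually_elim (auto simp: min_def max_def split: if_splits)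
qed

lemma measure_limit: "measure \<rho> {- \<omega>..\<omega>} = 1"
  using AE_limit by (subst \<rho>.prob_eq_1) (auto elim: eventually_mono)

lemma set_integral_limit:
  fixes f :: "real \<Rightarrow> real"
  assumes "f \<in> borel_measurable borel"
  shows "(LINT x:{- \<omega>..\<omega>}|\<rho>. f x) = integral\<^sup>L \<rho> f"
  unfolding set_lebesgue_integral_def
proof (rule integral_cong_AE)
  show "AE x in \<rho>. indicat_real {- \<omega>..\<omega>} x *\<^sub>R f x = f x"
    using AE_limit by eventually_elim (auto simp: abs_le_iff indicator_def)
qed (use assms in auto)

text \<open>Clamping the argument to the interval makes f bounded and leaves all integrals
  unchanged, so continuous functions unbounded on the line are covered.\<close>

lemma tendsto_integral:
  fixes f :: "real \<Rightarrow> real"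
  assumes f: "continuous_on UNIV f"
  shows "(\<lambda>n. integral\<^sup>L (\<mu> n) f) \<longlonglongrightarrow> integral\<^sup>L \<rho> f"
proof -
  define g where "g x = f (max (- \<omega>) (min \<omega> x))" for x
  have fm: "f \<in> borel_measurable borel" by (rule borel_measurable_continuous_onI[OF f])
  have gc: "continuous_on UNIV g"
    unfolding g_def by (intro continuous_on_compose2[OF f] continuous_intros) auto
  have gm: "g \<in> borel_measurable borel" by (rule borel_measurable_continuous_onI[OF gc])
  have "bounded (f ` {- \<omega>..\<omega>})"
    by (intro compact_imp_bounded compact_continuous_image continuous_on_subset[OF f]) auto
  then obtain B where B: "\<forall>x\<in>{- \<omega>..\<omega>}. \<bar>f x\<bar> \<le> B" unfolding bounded_iff by auto
  have "(\<lambda>n. integral\<^sup>L (\<mu> n) g) \<longlonglongrightarrow> integral\<^sup>L \<rho> g"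
  proof (rule tendsto_bounded_integral)
    show "isCont g x" for x using gc by (simp add: continuous_on_eq_continuous_at)
    show "\<bar>g x\<bar> \<le> B" for x unfolding g_def using \<omega> by (intro B[rule_format]) auto
  qed
  moreover have "integral\<^sup>L N g = integral\<^sup>L N f" if "real_distribution N" "AE x in N. \<bar>x\<bar> \<le> \<omega>" for N
  proof (rule integral_cong_AE)
    interpret real_distribution N by (rule that)
    show "g \<in> borel_measurable N" "f \<in> borel_measurable N" using fm gm by auto
    show "AE x in N. g x = f x"
      using that(2) by eventually_elim (auto simp: g_def max_def min_def)
  qed
  ultimately show ?thesis using \<mu> \<rho> supp AE_limit by simp
qed

text \<open>Weak convergence alone bounds only the limsup of the atoms by the atom of the limit. The
  hypothesis bounds the mass near 0 but off 0 by C/m, uniformly in n, so no such mass can flow into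
  the atom.\<close>

lemma tendsto_atom:
  assumes small: "\<And>n m. m > 0 \<Longrightarrow> m * measure (\<mu> n) {x. 0 < \<bar>x\<bar> \<and> \<bar>x\<bar> < exp (- m)} \<le> C"
  shows "(\<lambda>n. measure (\<mu> n) {0}) \<longlonglongrightarrow> measure \<rho> {0}"
proof (rule LIMSEQ_I)
  fix e :: real assume e: "e > 0"
  \<comment> \<open>A tent function of height 1 and half-width \<open>exp (- m)\<close>: its
    integral is close to the atom for \<rho> by dominated convergence, and for all the approximating
    measures at once by the hypothesis.\<close>
  define h where "h m x = max 0 (1 - \<bar>x\<bar> * exp (real m))" for m :: nat and x :: real
  have hm: "h m \<in> borel_measurable borel" for m unfolding h_def by measurable
  have hb: "0 \<le> h m x" "h m x \<le> 1" for m x unfolding h_def by auto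
  have h0: "h m x = 0" if "\<bar>x\<bar> \<ge> exp (- real m)" for m x
  proof -
    have "exp (- real m) * exp (real m) \<le> \<bar>x\<bar> * exp (real m)" using that by (intro mult_right_mono) auto
    then show ?thesis unfolding h_def by (simp flip: exp_add)
  qed
  have "(\<lambda>m. integral\<^sup>L \<rho> (h m)) \<longlonglongrightarrow> integral\<^sup>L \<rho> (indicator {0})"
  proof (rule integral_dominated_convergence[where w = "\<lambda>_. 1"])
    show "AE x in \<rho>. (\<lambda>m. h m x) \<longlonglongrightarrow> indicator {0} x"
    proof (rule AE_I2)
      fix x
      show "(\<lambda>m. h m x) \<longlonglongrightarrow> indicator {0} x"
      proof (cases "x = 0")
        case False
        have "(\<lambda>m. exp (- real m)) \<longlonglongrightarrow> 0" by real_asymp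
        then have "eventually (\<lambda>m. exp (- real m) < \<bar>x\<bar>) sequentially"
          using False by (intro order_tendstoD) auto
        then have "eventually (\<lambda>m. h m x = 0) sequentially" by eventually_elim (auto intro: h0)
        then show ?thesis using False by (simp add: tendsto_eventually)
      qed (simp add: h_def)
    qed
  qed (use hm hb in auto)
  then have "(\<lambda>m. integral\<^sup>L \<rho> (h m)) \<longlonglongrightarrow> measure \<rho> {0}" by simp
  then have "eventually (\<lambda>m. \<bar>integral\<^sup>L \<rho> (h m) - measure \<rho> {0}\<bar> < e / 3) sequentially"
    using e tendstoD[of _ "measure \<rho> {0}" sequentially "e / 3"] by (auto simp: dist_real_def)
  moreover have "(\<lambda>m. \<bar>C\<bar> / real m) \<longlonglongrightarrow> 0" by real_asymp
  then have "eventually (\<lambda>m. \<bar>C\<bar> / real m < e / 3) sequentially"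
    using e by (intro order_tendstoD) auto
  moreover have "eventually (\<lambda>m. m > 0) (sequentially :: nat filter)" by (rule eventually_gt_at_top)
  ultimately have "eventually (\<lambda>m. \<bar>integral\<^sup>L \<rho> (h m) - measure \<rho> {0}\<bar> < e / 3 \<and> \<bar>C\<bar> / real m < e / 3 \<and> m > 0) sequentially"
    by eventually_elim auto
  then obtain m where m: "\<bar>integral\<^sup>L \<rho> (h m) - measure \<rho> {0}\<bar> < e / 3" "\<bar>C\<bar> / real m < e / 3" "m > 0"
    by (auto simp: eventually_sequentially)
  have near: "\<bar>integral\<^sup>L (\<mu> n) (h m) - measure (\<mu> n) {0}\<bar> < e / 3" for n
  proof -
    interpret real_distribution "\<mu> n" by (rule \<mu>)
    let ?J = "{x. 0 < \<bar>x\<bar> \<and> \<bar>x\<bar> < exp (- real m)}"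
    have J: "?J \<in> sets borel" by measurable
    have int: "integrable (\<mu> n) (h m)"
      by (rule integrable_const_bound[where B = 1]) (use hm hb in auto)
    have int0: "integrable (\<mu> n) (indicat_real {0})" "integrable (\<mu> n) (indicat_real ?J)"
      using J by (auto intro!: integrable_const_bound[where B = 1])
    have "integral\<^sup>L (\<mu> n) (h m) - measure (\<mu> n) {0} = (\<integral>x. h m x - indicator {0} x \<partial>\<mu> n)"
      using int int0 by (subst Bochner_Integration.integral_diff) auto
    moreover have "0 \<le> (\<integral>x. h m x - indicator {0} x \<partial>\<mu> n)"
      by (rule integral_nonneg_AE) (auto simp: h_def indicator_def)
    moreover have "(\<integral>x. h m x - indicator {0} x \<partial>\<mu> n) \<le> (\<integral>x. indicator ?J x \<partial>\<mu> n)"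
    proof (rule integral_mono)
      fix x show "h m x - indicator {0} x \<le> indicat_real ?J x"
        using hb[of m x] h0[of m x] by (auto simp: indicator_def h_def)
    qed (use int int0 in auto)
    moreover have "(\<integral>x. indicator ?J x \<partial>\<mu> n) = measure (\<mu> n) ?J" using J by simp
    moreover have "measure (\<mu> n) ?J \<le> \<bar>C\<bar> / real m"
      using small[of "real m" n] m(3) by (simp add: field_simps)
    ultimately show ?thesis using m(2) by linarith
  qed
  have "(\<lambda>n. integral\<^sup>L (\<mu> n) (h m)) \<longlonglongrightarrow> integral\<^sup>L \<rho> (h m)"
    by (rule tendsto_integral) (auto simp: h_def intro!: continuous_intros)
  then obtain n0 where n0: "\<And>n. n \<ge> n0 \<Longrightarrow> \<bar>integral\<^sup>L (\<mu> n) (h m) - integral\<^sup>L \<rho> (h m)\<bar> < e / 3"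
    using e LIMSEQ_D[of _ _ "e / 3"] by (metis divide_pos_pos real_norm_def zero_less_numeral)
  show "\<exists>n0. \<forall>n\<ge>n0. norm (measure (\<mu> n) {0} - measure \<rho> {0}) < e"
  proof (intro exI allI impI)
    fix n assume "n \<ge> n0"
    then show "norm (measure (\<mu> n) {0} - measure \<rho> {0}) < e"
      using n0[of n] near[of n] m(1) unfolding real_norm_def by linarith
  qed
qed

text \<open>The truncations \<open>ln (max \<bar>x\<bar> (exp (- m)))\<close> are continuous and decrease to \<open>ln \<bar>x\<bar>\<close>.\<close>

lemma limsup_log_bound:
  fixes a :: "nat \<Rightarrow> ereal"
  assumes a: "\<And>n m. a n \<le> ereal (\<integral>x. ln (max \<bar>x\<bar> (exp (- real m))) \<partial>\<mu> n)"
  shows "limsup a \<le> ext_integral (restrict_space \<rho> {- \<omega>..\<omega>}) (\<lambda>x. ext_ln \<bar>x\<bar>)"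
proof -
  let ?K = "{- \<omega>..\<omega>}"
  define h where "h m x = ln (max \<bar>x\<bar> (exp (- real m)))" for m :: nat and x :: real
  \<comment> \<open>The positive part of the logarithm. At x = 0 the default \<open>ln 0 = 0\<close>
    gives the value 0, the correct positive part of minus infinity.\<close>
  define p where "p x = max 0 (ln \<bar>x\<bar>)" for x :: real
  \<comment> \<open>This increases with m to the negative part of ln |x|; at x = 0 it equals m.
    Monotone convergence then also covers an infinite limit.\<close>
  define q where "q m x = p x - h m x" for m :: nat and x :: real
  have ez: "max \<bar>x\<bar> (exp (- real m)) > 0" for x m by (simp add: less_max_iff_disj)
  have hc: "continuous_on UNIV (h m)" for m
    unfolding h_def using ez by (intro continuous_intros) (metis less_irrefl)+
  have hm: "h m \<in> borel_measurable borel" for m by (rule borel_measurable_continuous_onI[OF hc])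
  have pm: "p \<in> borel_measurable borel" unfolding p_def by measurable
  have qm: "q m \<in> borel_measurable borel" for m unfolding q_def using pm hm by measurable
  have p_alt: "p x = ln (max 1 \<bar>x\<bar>)" for x
    unfolding p_def by (cases "\<bar>x\<bar> \<ge> 1"; cases "x = 0") (auto simp: max_def ln_ge_zero)
  have hle: "h (Suc m) x \<le> h m x" for m x
    unfolding h_def by (intro iffD2[OF ln_le_cancel_iff[OF ez ez]] max.mono) auto
  have hp: "h m x \<le> p x" for m x
    unfolding h_def p_alt
  proof (rule iffD2[OF ln_le_cancel_iff[OF ez]])
    have "exp (- real m) \<le> 1" by simp
    then show "max \<bar>x\<bar> (exp (- real m)) \<le> max 1 \<bar>x\<bar>" by linarith
  qed auto
  have hb: "- real m \<le> h m x" for m x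
    unfolding h_def using ln_le_cancel_iff[of "exp (- real m)" "max \<bar>x\<bar> (exp (- real m))"] ez by simp
  have pb: "0 \<le> p x" "\<bar>x\<bar> \<le> \<omega> \<Longrightarrow> p x \<le> ln \<omega>" for x
    unfolding p_alt using \<omega> by auto
  have q0: "0 \<le> q m x" for m x unfolding q_def using hp by simp
  have pint: "integrable \<rho> p"
  proof (rule \<rho>.integrable_const_bound[where B = "ln \<omega>"])
    show "AE x in \<rho>. norm (p x) \<le> ln \<omega>" using AE_limit by eventually_elim (use pb in auto)
  qed (use pm in simp)
  have hint: "integrable \<rho> (h m)" for m
  proof (rule \<rho>.integrable_const_bound[where B = "ln \<omega> + real m"])
    show "AE x in \<rho>. norm (h m x) \<le> ln \<omega> + real m"
      using AE_limit
    proof eventually_elim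
      fix x assume "\<bar>x\<bar> \<le> \<omega>"
      then show "norm (h m x) \<le> ln \<omega> + real m"
        using pb[of x] hp[of m x] hb[of m x] \<omega> ln_ge_zero[of \<omega>] unfolding real_norm_def by linarith
    qed
  qed (use hm in simp)
  have pos: "(\<integral>\<^sup>+x. e2ennreal (ext_ln \<bar>x\<bar>) \<partial>restrict_space \<rho> ?K) = ennreal (integral\<^sup>L \<rho> p)"
  proof -
    have "(\<integral>\<^sup>+x. e2ennreal (ext_ln \<bar>x\<bar>) \<partial>restrict_space \<rho> ?K) = (\<integral>\<^sup>+x. e2ennreal (ext_ln \<bar>x\<bar>) * indicator ?K x \<partial>\<rho>)"
      by (rule nn_integral_restrict_space) simp
    also have "\<dots> = (\<integral>\<^sup>+x. ennreal (p x) \<partial>\<rho>)"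
    proof (rule nn_integral_cong_AE)
      show "AE x in \<rho>. e2ennreal (ext_ln \<bar>x\<bar>) * indicator ?K x = ennreal (p x)"
        using AE_limit
      proof eventually_elim
        fix x assume "\<bar>x\<bar> \<le> \<omega>"
        then have "x \<in> ?K" by auto
        then show "e2ennreal (ext_ln \<bar>x\<bar>) * indicator ?K x = ennreal (p x)"
          unfolding ext_ln_def p_def by (auto simp: e2ennreal_neg max_def ennreal_neg)
      qed
    qed
    also have "\<dots> = ennreal (integral\<^sup>L \<rho> p)"
      by (rule nn_integral_eq_integral[OF pint]) (use pb in auto)
    finally show ?thesis .
  qed
  have neg: "(\<lambda>m. ennreal (integral\<^sup>L \<rho> (q m))) \<longlonglongrightarrow> (\<integral>\<^sup>+x. e2ennreal (- ext_ln \<bar>x\<bar>) \<partial>restrict_space \<rho> ?K)"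
  proof -
    have lim: "(\<lambda>m. ennreal (q m x)) \<longlonglongrightarrow> e2ennreal (- ext_ln \<bar>x\<bar>)" for x
    proof (cases "x = 0")
      case True
      have "(\<lambda>m. ennreal (real m)) \<longlonglongrightarrow> top"
        by (simp add: ennreal_of_nat_eq_real_of_nat[symmetric] of_nat_tendsto_top_ennreal)
      then show ?thesis using True by (simp add: q_def p_def h_def ext_ln_def max_def)
    next
      case False
      have "(\<lambda>m. exp (- real m)) \<longlonglongrightarrow> 0" by real_asymp
      then have "eventually (\<lambda>m. exp (- real m) < \<bar>x\<bar>) sequentially"
        using False by (intro order_tendstoD) auto
      then have "eventually (\<lambda>m. ennreal (q m x) = e2ennreal (- ext_ln \<bar>x\<bar>)) sequentially"
      proof eventually_elim
        fix m assume "exp (- real m) < \<bar>x\<bar>"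
        then have "q m x = max 0 (- ln \<bar>x\<bar>)" unfolding q_def h_def p_def by (auto simp: max_def)
        then show "ennreal (q m x) = e2ennreal (- ext_ln \<bar>x\<bar>)"
          using False by (auto simp: ext_ln_def max_def e2ennreal_neg ennreal_eq_0_iff)
      qed
      then show ?thesis by (rule tendsto_eventually)
    qed
    have inc: "incseq (\<lambda>m x. ennreal (q m x))"
      using hle by (intro incseq_SucI le_funI ennreal_leI) (simp add: q_def)
    have "(SUP m. ennreal (q m x)) = e2ennreal (- ext_ln \<bar>x\<bar>)" for x
    proof -
      have "incseq (\<lambda>m. ennreal (q m x))" using inc by (auto simp: incseq_def le_fun_def)
      from LIMSEQ_unique[OF LIMSEQ_SUP[OF this] lim] show ?thesis .
    qed
    then have "(\<integral>\<^sup>+x. e2ennreal (- ext_ln \<bar>x\<bar>) \<partial>\<rho>) = (SUP m. \<integral>\<^sup>+x. ennreal (q m x) \<partial>\<rho>)"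
      using nn_integral_monotone_convergence_SUP[OF inc, of \<rho>] qm by simp
    moreover have "(\<integral>\<^sup>+x. ennreal (q m x) \<partial>\<rho>) = ennreal (integral\<^sup>L \<rho> (q m))" for m
      by (rule nn_integral_eq_integral) (use pint hint q0 in \<open>auto simp: q_def\<close>)
    moreover have "incseq (\<lambda>m. \<integral>\<^sup>+x. ennreal (q m x) \<partial>\<rho>)"
      using hle by (intro incseq_SucI nn_integral_mono ennreal_leI) (simp add: q_def)
    ultimately have "(\<lambda>m. ennreal (integral\<^sup>L \<rho> (q m))) \<longlonglongrightarrow> (\<integral>\<^sup>+x. e2ennreal (- ext_ln \<bar>x\<bar>) \<partial>\<rho>)"
      using LIMSEQ_SUP[of "\<lambda>m. \<integral>\<^sup>+x. ennreal (q m x) \<partial>\<rho>"] by simp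
    moreover have "(\<integral>\<^sup>+x. e2ennreal (- ext_ln \<bar>x\<bar>) \<partial>restrict_space \<rho> ?K)
        = (\<integral>\<^sup>+x. e2ennreal (- ext_ln \<bar>x\<bar>) * indicator ?K x \<partial>\<rho>)"
      by (rule nn_integral_restrict_space) simp
    moreover have "\<dots> = (\<integral>\<^sup>+x. e2ennreal (- ext_ln \<bar>x\<bar>) \<partial>\<rho>)"
    proof (rule nn_integral_cong_AE)
      show "AE x in \<rho>. e2ennreal (- ext_ln \<bar>x\<bar>) * indicator ?K x = e2ennreal (- ext_ln \<bar>x\<bar>)"
        using AE_limit by eventually_elim (auto simp: indicator_def)
    qed
    ultimately show ?thesis by simp
  qed
  \<comment> \<open>For fixed m the truncation is continuous, so weak convergence applies before m
    is sent to infinity.\<close>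
  have le: "limsup a \<le> ereal (integral\<^sup>L \<rho> (h m))" for m
  proof -
    have "(\<lambda>n. ereal (integral\<^sup>L (\<mu> n) (h m))) \<longlonglongrightarrow> ereal (integral\<^sup>L \<rho> (h m))"
      using tendsto_integral[OF hc] by simp
    then have "limsup (\<lambda>n. ereal (integral\<^sup>L (\<mu> n) (h m))) = ereal (integral\<^sup>L \<rho> (h m))"
      by (rule lim_imp_Limsup[OF sequentially_bot])
    moreover have "limsup a \<le> limsup (\<lambda>n. ereal (integral\<^sup>L (\<mu> n) (h m)))"
      using a by (intro Limsup_mono always_eventually) (simp add: h_def[abs_def])
    ultimately show ?thesis by simp
  qed
  let ?N = "\<integral>\<^sup>+x. e2ennreal (- ext_ln \<bar>x\<bar>) \<partial>restrict_space \<rho> ?K"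
  have p0: "integral\<^sup>L \<rho> p \<ge> 0" by (rule integral_nonneg_AE) (use pb in auto)
  have Q0: "integral\<^sup>L \<rho> (q m) \<ge> 0" for m by (rule integral_nonneg_AE) (use q0 in auto)
  have "(\<lambda>m. enn2ereal (ennreal (integral\<^sup>L \<rho> (q m)))) \<longlonglongrightarrow> enn2ereal ?N"
    by (rule tendsto_enn2erealI[OF neg])
  \<comment> \<open>The first term is finite, so the difference is well defined even if the second
    integral is infinite.\<close>
  then have "(\<lambda>m. ereal (integral\<^sup>L \<rho> p) - ereal (integral\<^sup>L \<rho> (q m))) \<longlonglongrightarrow> ereal (integral\<^sup>L \<rho> p) - enn2ereal ?N"
    using Q0 by (intro tendsto_diff_ereal_general tendsto_const) (auto simp: enn2ereal_ennreal)
  moreover have "ereal (integral\<^sup>L \<rho> p) - ereal (integral\<^sup>L \<rho> (q m)) = ereal (integral\<^sup>L \<rho> (h m))" for m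
    unfolding q_def using pint hint by (simp add: Bochner_Integration.integral_diff)
  ultimately have "(\<lambda>m. ereal (integral\<^sup>L \<rho> (h m))) \<longlonglongrightarrow> ereal (integral\<^sup>L \<rho> p) - enn2ereal ?N" by simp
  then have "limsup a \<le> ereal (integral\<^sup>L \<rho> p) - enn2ereal ?N"
    by (rule LIMSEQ_le_const) (use le in auto)
  then show ?thesis
    unfolding ext_integral_def pos using p0 by (simp add: enn2ereal_ennreal)
qed

end

section \<open>Limits of matching parameters\<close>

lemma measure_matching_measure:
  assumes lam: "graph_roots G lam" and A: "A \<in> sets borel"
  shows "measure (matching_measure G) A = real (card {i. i < vnum G \<and> lam i \<in> A}) / real (vnum G)"
proof -
  have n: "{..<vnum G} \<noteq> {}" using lam finite_graphD(3)[of G] unfolding graph_roots_def by auto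
  have "measure (matching_measure G) A = measure (measure_pmf (pmf_of_set {..<vnum G})) (lam -` A)"
    unfolding matching_measure_eq[OF lam] using A by (subst measure_distr) auto
  also have "\<dots> = real (card ({..<vnum G} \<inter> lam -` A)) / real (vnum G)"
    using n by (subst measure_pmf_of_set) auto
  also have "{..<vnum G} \<inter> lam -` A = {i. i < vnum G \<and> lam i \<in> A}" by auto
  finally show ?thesis .
qed

lemma ln_num_matchings_integral:
  assumes lam: "graph_roots G lam"
  shows "ln (real (num_matchings G)) / real (vnum G)
    = 1 / 2 * (\<integral>x. ln (1 + x ^ 2) \<partial>matching_measure G)"
proof -
  have "(\<integral>x. ln (1 + x ^ 2) \<partial>matching_measure G) = (\<Sum>i<vnum G. ln (1 + lam i ^ 2)) / real (vnum G)"
    by (rule integral_matching_measure[OF lam]) measurable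
  moreover have "ln (real (num_matchings G)) = (\<Sum>i<vnum G. ln (1 + lam i ^ 2)) / 2"
    using ln_matching_sum[OF lam, of 1] by (simp add: num_matchings_def)
  ultimately show ?thesis by (simp only:)
qed

lemma expected_matching_size_integral:
  assumes lam: "graph_roots G lam"
  shows "expected_matching_size G / real (vnum G)
    = 1 / 2 * (\<integral>x. x ^ 2 / (1 + x ^ 2) \<partial>matching_measure G)"
proof -
  have "(\<integral>x. x ^ 2 / (1 + x ^ 2) \<partial>matching_measure G)
      = (\<Sum>i<vnum G. lam i ^ 2 / (1 + lam i ^ 2)) / real (vnum G)"
    by (rule integral_matching_measure[OF lam]) measurable
  then show ?thesis unfolding expected_matching_size_eq[OF lam] by simp
qed

lemma variance_matching_size_integral:
  assumes lam: "graph_roots G lam"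
  shows "variance_matching_size G / real (vnum G)
    = 1 / 2 * (\<integral>x. x ^ 2 / (1 + x ^ 2) ^ 2 \<partial>matching_measure G)"
proof -
  have "(\<integral>x. x ^ 2 / (1 + x ^ 2) ^ 2 \<partial>matching_measure G)
      = (\<Sum>i<vnum G. lam i ^ 2 / (1 + lam i ^ 2) ^ 2) / real (vnum G)"
    by (rule integral_matching_measure[OF lam]) measurable
  then show ?thesis unfolding variance_matching_size_eq[OF lam] by simp
qed

text \<open>By \<open>card_nonzero_roots\<close> the root 0 has multiplicity v(G) - 2
  \<nu>(G).\<close>

lemma matching_number_atom:
  assumes lam: "graph_roots G lam"
  shows "real (matching_number G) / real (vnum G) = (1 - measure (matching_measure G) {0}) / 2"
proof -
  have n: "vnum G > 0" using lam finite_graphD(3)[of G] unfolding graph_roots_def by auto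
  have "card {..<vnum G} = card ({i. i < vnum G \<and> lam i \<in> {0}} \<union> {i. i < vnum G \<and> lam i \<noteq> 0})"
    by (rule arg_cong[of _ _ card]) auto
  also have "\<dots> = card {i. i < vnum G \<and> lam i \<in> {0}} + 2 * matching_number G"
    unfolding card_nonzero_roots[OF lam, symmetric] by (rule card_Un_disjoint) auto
  finally have "real (card {i. i < vnum G \<and> lam i \<in> {0}}) = real (vnum G) - 2 * real (matching_number G)"
    by simp
  then have "measure (matching_measure G) {0} = (real (vnum G) - 2 * real (matching_number G)) / real (vnum G)"
    using measure_matching_measure[OF lam, of "{0}"] by simp
  then show ?thesis using n by (simp add: field_simps)
qed

text \<open>\<open>card_small_roots\<close> in the form required by \<open>tendsto_atom\<close>: the
  bound depends on d but on neither the graph nor m.\<close>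

lemma measure_small_roots:
  assumes lam: "graph_roots G lam" and d: "d \<ge> 2" "max_degree_le G d" and m: "m > 0"
  shows "m * measure (matching_measure G) {x. 0 < \<bar>x\<bar> \<and> \<bar>x\<bar> < exp (- m)} \<le> ln (2 * sqrt (real d - 1))"
proof -
  have n: "vnum G > 0" using lam finite_graphD(3)[of G] unfolding graph_roots_def by auto
  have "sqrt (real d - 1) \<ge> 1" using d(1) by simp
  then have \<omega>: "2 * sqrt (real d - 1) \<ge> 1" by linarith
  have "m * real (card {i. i < vnum G \<and> 0 < \<bar>lam i\<bar> \<and> \<bar>lam i\<bar> < exp (- m)})
      \<le> real (vnum G) * ln (2 * sqrt (real d - 1))"
    by (rule card_small_roots[OF lam _ \<omega> m]) (rule graph_roots_bound[OF lam d])
  moreover have "{x::real. 0 < \<bar>x\<bar> \<and> \<bar>x\<bar> < exp (- m)} \<in> sets borel" by measurable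
  then have "measure (matching_measure G) {x. 0 < \<bar>x\<bar> \<and> \<bar>x\<bar> < exp (- m)}
      = real (card {i. i < vnum G \<and> 0 < \<bar>lam i\<bar> \<and> \<bar>lam i\<bar> < exp (- m)}) / real (vnum G)"
    using measure_matching_measure[OF lam, of "{x. 0 < \<bar>x\<bar> \<and> \<bar>x\<bar> < exp (- m)}"] by simp
  ultimately show ?thesis using n by (simp only: times_divide_eq_right pos_divide_le_eq of_nat_0_less_iff mult.commute)
qed

lemma ln_perfect_matchings_le:
  assumes lam: "graph_roots G lam"
  shows "ext_ln (real (num_perfect_matchings G)) / ereal (real (vnum G))
    \<le> ereal (\<integral>x. ln (max \<bar>x\<bar> (exp (- real m))) \<partial>matching_measure G)"
proof -
  have n: "vnum G > 0" using lam finite_graphD(3)[of G] unfolding graph_roots_def by auto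
  show ?thesis
  proof (cases "num_perfect_matchings G = 0")
    \<comment> \<open>Here the left-hand side is minus infinity.\<close>
    case True
    then show ?thesis using n by (simp add: ext_ln_def)
  next
    case False
    then have pm: "num_perfect_matchings G > 0" by simp
    have "ln \<bar>lam i\<bar> \<le> ln (max \<bar>lam i\<bar> (exp (- real m)))" if "i < vnum G" for i
      using ln_perfect_matchings(2)[OF lam pm that] by (subst ln_le_cancel_iff) (auto simp: less_max_iff_disj)
    then have "ln (real (num_perfect_matchings G)) \<le> (\<Sum>i<vnum G. ln (max \<bar>lam i\<bar> (exp (- real m))))"
      unfolding ln_perfect_matchings(1)[OF lam pm] by (intro sum_mono) auto
    moreover have "(\<integral>x. ln (max \<bar>x\<bar> (exp (- real m))) \<partial>matching_measure G)
        = (\<Sum>i<vnum G. ln (max \<bar>lam i\<bar> (exp (- real m)))) / real (vnum G)"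
      by (rule integral_matching_measure[OF lam]) measurable
    ultimately show ?thesis using pm n by (simp add: ext_ln_def divide_right_mono)
  qed
qed

section \<open>Assembly of the limits\<close>

lemma matching_measures_converge:
  fixes G :: "nat \<Rightarrow> 'a ugraph"
  assumes G: "\<And>n. finite_graph (G n)" and d: "d \<ge> 2" "\<And>n. max_degree_le (G n) d"
    and bs: "bs_convergent G"
  shows "\<exists>\<rho>. weak_limit (\<lambda>n. matching_measure (G n)) \<rho> (2 * sqrt (real d - 1))"
proof -
  let ?\<omega> = "2 * sqrt (real d - 1)"
  have \<omega>: "?\<omega> \<ge> 1" using real_sqrt_ge_one[of "real d - 1"] d(1) by linarith
  obtain lam where lam: "\<And>n. graph_roots (G n) (lam n)" using graph_roots_exist[OF G] by metis
  have "(\<integral>x. x ^ k \<partial>matching_measure (G n)) = (\<Sum>v\<in>verts (G n). root_moment (G n, v) k) / real (vnum (G n))" for n k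
    unfolding sum_root_moment[OF lam] by (rule integral_matching_measure[OF lam]) measurable
  then have mom: "convergent (\<lambda>n. \<integral>x. x ^ k \<partial>matching_measure (G n))" for k
    using moments_convergent[OF G d(2) bs] by simp
  have supp: "AE x in matching_measure (G n). \<bar>x\<bar> \<le> ?\<omega>" for n
    by (rule AE_matching_measure[OF lam d])
  have "?\<omega> \<ge> 0" using \<omega> by linarith
  from ex_weak_limit_of_moments[OF real_distribution_matching_measure supp this mom]
  obtain \<rho> where "real_distribution \<rho>" "weak_conv_m (\<lambda>n. matching_measure (G n)) \<rho>" by blast
  then show ?thesis using supp \<omega> real_distribution_matching_measure unfolding weak_limit_def by blast
qed

text \<open>Each parameter per vertex is an integral against the matching measure or is read off its
  atom at 0. The integrands in the first three claims are continuous; the last two claims rest on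
  \<open>tendsto_atom\<close> and \<open>limsup_log_bound\<close>.\<close>

lemma matching_limits:
  fixes G :: "nat \<Rightarrow> 'a ugraph"
  assumes G: "\<And>n. finite_graph (G n)" and d: "d \<ge> 2" "\<And>n. max_degree_le (G n) d"
    and lim: "weak_limit (\<lambda>n. matching_measure (G n)) \<rho> (2 * sqrt (real d - 1))"
  defines "K \<equiv> {- (2 * sqrt (real d - 1))..2 * sqrt (real d - 1)}"
  shows "(\<lambda>n. ln (real (num_matchings (G n))) / real (vnum (G n)))
      \<longlonglongrightarrow> 1 / 2 * (LINT x:K|\<rho>. ln (1 + x ^ 2))" (is ?ln)
    and "(\<lambda>n. expected_matching_size (G n) / real (vnum (G n)))
      \<longlonglongrightarrow> 1 / 2 * (LINT x:K|\<rho>. x ^ 2 / (1 + x ^ 2))" (is ?exp)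
    and "(\<lambda>n. variance_matching_size (G n) / real (vnum (G n)))
      \<longlonglongrightarrow> 1 / 2 * (LINT x:K|\<rho>. x ^ 2 / (1 + x ^ 2) ^ 2)" (is ?var)
    and "(\<lambda>n. real (matching_number (G n)) / real (vnum (G n)))
      \<longlonglongrightarrow> (1 - measure \<rho> {0}) / 2" (is ?nu)
    and "limsup (\<lambda>n. ext_ln (real (num_perfect_matchings (G n))) / ereal (real (vnum (G n))))
      \<le> ext_integral (restrict_space \<rho> K) (\<lambda>x. ext_ln \<bar>x\<bar>)" (is ?pm)
proof -
  interpret weak_limit "\<lambda>n. matching_measure (G n)" \<rho> "2 * sqrt (real d - 1)" by (rule lim)
  obtain lam where lam: "\<And>n. graph_roots (G n) (lam n)" using graph_roots_exist[OF G] by metis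
  have nz: "1 + x ^ 2 \<noteq> 0" for x :: real using add_pos_nonneg[of 1 "x ^ 2"] by simp
  have pos: "1 + x ^ 2 > 0" for x :: real by (simp add: add_pos_nonneg)
  have cont: "(\<lambda>n. 1 / 2 * integral\<^sup>L (matching_measure (G n)) f) \<longlonglongrightarrow> 1 / 2 * (LINT x:K|\<rho>. f x)"
    if f: "continuous_on UNIV f" for f :: "real \<Rightarrow> real"
    unfolding K_def set_integral_limit[OF borel_measurable_continuous_onI[OF f]]
    by (intro tendsto_mult tendsto_const tendsto_integral f)
  show ?ln unfolding ln_num_matchings_integral[OF lam]
    by (rule cont) (use nz in \<open>auto intro!: continuous_intros\<close>)
  show ?exp unfolding expected_matching_size_integral[OF lam]
    by (rule cont) (use nz in \<open>auto intro!: continuous_intros\<close>)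
  show ?var unfolding variance_matching_size_integral[OF lam]
    by (rule cont) (use nz in \<open>auto intro!: continuous_intros\<close>)
  show ?nu unfolding matching_number_atom[OF lam]
    by (intro tendsto_divide tendsto_diff tendsto_const tendsto_atom[OF measure_small_roots[OF lam d]]) auto
  show ?pm unfolding K_def by (rule limsup_log_bound) (rule ln_perfect_matchings_le[OF lam])
qed

lemma matching_parameters_estimable:
  shows "estimable (\<lambda>H :: 'a ugraph. ln (real (num_matchings H)) / real (vnum H))" (is "estimable ?p1")
    and "estimable (\<lambda>H :: 'a ugraph. expected_matching_size H / real (vnum H))" (is "estimable ?p2")
    and "estimable (\<lambda>H :: 'a ugraph. variance_matching_size H / real (vnum H))" (is "estimable ?p3")
    and "estimable (\<lambda>H :: 'a ugraph. real (matching_number H) / real (vnum H))" (is "estimable ?p4")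
proof -
  have "convergent (\<lambda>n. ?p1 (G n)) \<and> convergent (\<lambda>n. ?p2 (G n)) \<and>
      convergent (\<lambda>n. ?p3 (G n)) \<and> convergent (\<lambda>n. ?p4 (G n))"
    if G: "\<forall>n. finite_graph (G n)" and d: "\<forall>n. max_degree_le (G n) d" and bs: "bs_convergent G"
    for G :: "nat \<Rightarrow> 'a ugraph" and d
  proof -
    have G': "finite_graph (G n)" for n using G by blast
    \<comment> \<open>Estimability allows any degree bound, so it is raised to at least 2.\<close>
    have d': "max 2 d \<ge> 2" "max_degree_le (G n) (max 2 d)" for n
      using d unfolding max_degree_le_def by (simp, meson le_max_iff_disj)
    obtain \<rho> where "weak_limit (\<lambda>n. matching_measure (G n)) \<rho> (2 * sqrt (real (max 2 d) - 1))"
      using matching_measures_converge[OF G' d' bs] by blast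
    from matching_limits[OF G' d' this] show ?thesis unfolding convergent_def by auto
  qed
  then show "estimable ?p1" "estimable ?p2" "estimable ?p3" "estimable ?p4"
    unfolding estimable_def by blast+
qed

theorem theorem3p5:
  fixes G :: "nat \<Rightarrow> 'a ugraph" and d :: nat
  assumes "\<And>n. finite_graph (G n)"
    and "d \<ge> 2"
    and "\<And>n. max_degree_le (G n) d"
    and "bs_convergent G"
  shows "(let \<omega> = 2 * sqrt (real d - 1); K = {- \<omega>..\<omega>} in
      \<exists>\<rho> :: real measure.
        real_distribution \<rho> \<and> measure \<rho> K = 1 \<and>
        weak_conv_m (\<lambda>n. matching_measure (G n)) \<rho> \<and>
        (\<lambda>n. ln (real (num_matchings (G n))) / real (vnum (G n)))
          \<longlonglongrightarrow> 1 / 2 * (LINT x:K|\<rho>. ln (1 + x ^ 2)) \<and>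
        (\<lambda>n. expected_matching_size (G n) / real (vnum (G n)))
          \<longlonglongrightarrow> 1 / 2 * (LINT x:K|\<rho>. x ^ 2 / (1 + x ^ 2)) \<and>
        (\<lambda>n. variance_matching_size (G n) / real (vnum (G n)))
          \<longlonglongrightarrow> 1 / 2 * (LINT x:K|\<rho>. x ^ 2 / (1 + x ^ 2) ^ 2) \<and>
        (\<lambda>n. real (matching_number (G n)) / real (vnum (G n)))
          \<longlonglongrightarrow> (1 - measure \<rho> {0}) / 2 \<and>
        limsup (\<lambda>n. ext_ln (real (num_perfect_matchings (G n))) / ereal (real (vnum (G n))))
          \<le> ext_integral (restrict_space \<rho> K) (\<lambda>x. ext_ln \<bar>x\<bar>)) \<and>
    estimable (\<lambda>H :: 'a ugraph. ln (real (num_matchings H)) / real (vnum H)) \<and>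
    estimable (\<lambda>H :: 'a ugraph. expected_matching_size H / real (vnum H)) \<and>
    estimable (\<lambda>H :: 'a ugraph. variance_matching_size H / real (vnum H)) \<and>
    estimable (\<lambda>H :: 'a ugraph. real (matching_number H) / real (vnum H))"
proof -
  obtain \<rho> where lim: "weak_limit (\<lambda>n. matching_measure (G n)) \<rho> (2 * sqrt (real d - 1))"
    using matching_measures_converge[OF assms] by blast
  interpret weak_limit "\<lambda>n. matching_measure (G n)" \<rho> "2 * sqrt (real d - 1)" by (rule lim)
  show ?thesis
    unfolding Let_def
    by (intro conjI exI[of _ \<rho>] \<rho> measure_limit conv matching_limits[OF assms(1-3) lim]
        matching_parameters_estimable)
qed

end
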